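(* Let $a_1,a_2,c_1,c_2\in\mathbb{R}$ satisfy $a_1<a_2$, $c_1<c_2$, $a_1+c_1<0$, $a_2+c_2>0$, and let $p^i(x)=a_ix_1^2+c_ix_2^2$, $i=1,2$, on $\mathbb{R}^2$. There exist double-cone solutions for the double obstacle problem with obstacles $p^1,p^2$ if and only if the polynomial $$P(x_1,x_2):=p^1(x_1,x_2)+p^2(x_2,x_1)=(a_1+c_2)x_1^2+(c_1+a_2)x_2^2$$ has no sign. If $P\equiv0$, there are infinitely many double-cone solutions. If $P$ changes sign, then there are four double-cone solutions, and if $P$ has a sign, there are none.
   Context: A polynomial $P$ is said to have a sign if $P\not\equiv0$ and either $P\ge0$ everywhere or $P\le 0$ everywhere; otherwise it has no sign. Let $\lambda_i=\Delta p^i$. A global solution to the (normalised) double obstacle problem with obstacles $p^1\le p^2$ is a function $u\in C^{1,1}_{loc}(\mathbb{R}^2)$ with $p^1\le u\le p^2$ and $\Delta u=\lambda_1\chi_{\{u=p^1\}}+\lambda_2\chi_{\{u=p^2\}}$ a.e. in $\mathbb{R}^2$. A double-cone solution is a global solution $u$ such that both $\{u=p^1\}$ and $\{u=p^2\}$ are halfcones with a common vertex (here the origin); a halfcone in $\mathbb{R}^2$ is a closed sector $\{(r\cos\theta,r\sin\theta): r\ge0,\ \theta\in[a,b]\}$ with opening angle $b-a\in(0,\pi)$. *)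

theory Defs
  imports "HOL-Analysis.Analysis"
begin

definition has_sign :: "(real^2 \<Rightarrow> real) \<Rightarrow> bool" where
  "has_sign P \<longleftrightarrow> (\<exists>x. P x \<noteq> 0) \<and> ((\<forall>x. P x \<ge> 0) \<or> (\<forall>x. P x \<le> 0))"

definition changes_sign :: "(real^2 \<Rightarrow> real) \<Rightarrow> bool" where
  "changes_sign P \<longleftrightarrow> (\<exists>x. P x > 0) \<and> (\<exists>x. P x < 0)"

definition C11_loc :: "('a::euclidean_space \<Rightarrow> real) \<Rightarrow> bool" where
  "C11_loc u \<longleftrightarrow>
     (\<exists>g. (\<forall>x. GDERIV u x :> g x) \<and> (\<forall>K. compact K \<longrightarrow> (\<exists>L. L-lipschitz_on K g)))"

text \<open>The Laplacian at a point is the trace of the derivative of the gradient, whose existence at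
  that point is part of the predicate. For locally \<open>C\<close>-1,1 functions the gradient is differentiable
  almost everywhere (Rademacher) and this agrees almost everywhere with the weak Laplacian.\<close>

definition has_laplacian :: "('a::euclidean_space \<Rightarrow> real) \<Rightarrow> real \<Rightarrow> 'a \<Rightarrow> bool" where
  "has_laplacian u l x \<longleftrightarrow>
     (\<exists>g H. (\<forall>\<^sub>F y in nhds x. GDERIV u y :> g y) \<and> (g has_derivative H) (at x) \<and>
            l = (\<Sum>b\<in>Basis. H b \<bullet> b))"

definition laplacian :: "('a::euclidean_space \<Rightarrow> real) \<Rightarrow> 'a \<Rightarrow> real" where
  "laplacian u x = (THE l. has_laplacian u l x)"

definition double_obstacle_solution ::
    "(real^2 \<Rightarrow> real) \<Rightarrow> (real^2 \<Rightarrow> real) \<Rightarrow> (real^2 \<Rightarrow> real) \<Rightarrow> bool" where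
  "double_obstacle_solution p1 p2 u \<longleftrightarrow>
     C11_loc u \<and> (\<forall>x. p1 x \<le> u x \<and> u x \<le> p2 x) \<and>
     (AE x in lebesgue. has_laplacian u
        (laplacian p1 x * indicator {y. u y = p1 y} x +
         laplacian p2 x * indicator {y. u y = p2 y} x) x)"

definition halfcone :: "(real^2) set \<Rightarrow> bool" where
  "halfcone K \<longleftrightarrow>
     (\<exists>a b. 0 < b - a \<and> b - a < pi \<and>
        K = {vector [r * cos \<theta>, r * sin \<theta>] | r \<theta>. r \<ge> 0 \<and> \<theta> \<in> {a..b}})"

definition double_cone_solution ::
    "(real^2 \<Rightarrow> real) \<Rightarrow> (real^2 \<Rightarrow> real) \<Rightarrow> (real^2 \<Rightarrow> real) \<Rightarrow> bool" where
  "double_cone_solution p1 p2 u \<longleftrightarrow>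
     double_obstacle_solution p1 p2 u \<and> halfcone {x. u x = p1 x} \<and> halfcone {x. u x = p2 x}"

end

theory Submission
  imports Defs "HOL-Complex_Analysis.Conformal_Mappings"
begin

text \<open>Let \<open>u\<close> be a double-cone solution and put \<open>m\<^sub>i = a\<^sub>i + c\<^sub>i\<close>, \<open>d\<^sub>i = a\<^sub>i - c\<^sub>i\<close>. In a noncontact sector that
  starts at the edge of angle \<open>t\<close> of the contact sector of \<open>p1\<close>, \<open>u\<close> is harmonic with the Cauchy data of
  \<open>p1\<close> on that edge, hence equals \<open>p1 - m\<^sub>1 (x \<bullet> n\<^sub>t)\<^sup>2\<close> with \<open>n\<^sub>t\<close> normal to the edge. At the other edge, of
  angle \<open>s\<close>, it must equal \<open>p2 - m\<^sub>2 (x \<bullet> n\<^sub>s)\<^sup>2\<close>, which means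
  \<open>d\<^sub>1 + m\<^sub>1 cis (2t) = d\<^sub>2 + m\<^sub>2 cis (2s)\<close>: a point common to two circles. The circles coincide if
  \<open>P \<equiv> 0\<close>, meet in two conjugate points if \<open>P\<close> changes sign, and meet at most on the real axis if \<open>P\<close> has
  a sign. Since the opening is less than \<open>pi\<close>, the two edges of the contact sector have different values
  of \<open>cis (2t)\<close>; so they use both intersection points, which gives four sectors, and a single or missing
  intersection point gives none. The sector determines \<open>u\<close>.

  Unique continuation for equations that hold only almost everywhere rests on dominated convergence
  for difference quotients: the gradient has zero flux through rectangles, so it is the conjugate of
  a holomorphic function.\<close>

section \<open>Unique continuation for almost everywhere harmonic functions\<close>

text \<open>How \<open>P\<close> enters: let \<open>D = (a1 - c1) - (a2 - c2)\<close> be the offset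
  of the two centres. It is the difference of the coefficients \<open>a1 + c2\<close> and
  \<open>c1 + a2\<close> of \<open>P\<close>, and the sum of the signed radii is the sum of these
  coefficients. The number of common points is governed by Heron's product for the triangle with
  sides |D|, |a1 + c1|, |a2 + c2|, which factors as -16 (a2 - a1) (c2 - c1) (a1 + c2) (c1 + a2); its
  sign is opposite to that of the product of the coefficients of \<open>P\<close>. The obstacle in
  the necessity part is that a noncontact sector might be wider than \<open>pi\<close>, whereas
  unique continuation is proved on convex sets. It is therefore applied on wedges of opening less
  than \<open>pi\<close> across an edge, and an opening of \<open>pi\<close> or more is excluded
  because the harmonic continuation of \<open>p1\<close> meets \<open>p1\<close> again on the
  opposite ray. For existence, the signs of \<open>a1 + c1\<close> and \<open>a2 + c2\<close> place
  the harmonic piece between the obstacles.\<close>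

lemma integral_difference_quotient_tendsto:
  fixes f :: "real \<Rightarrow> real"
  assumes cont: "continuous_on UNIV f" and "a \<le> b"
  shows "(\<lambda>k. integral {a..b} (\<lambda>x. (f (x + 1 / real (Suc k)) - f x) * real (Suc k))) \<longlonglongrightarrow> f b - f a"
proof -
  \<comment> \<open>Integrating the quotient of \<open>f\<close> gives quotients of a primitive
    \<open>F\<close> at \<open>b\<close> and at \<open>a\<close>, so continuity of \<open>f\<close>
    is enough. The interval is enlarged by 1 so that \<open>F\<close> is differentiable from both
    sides at \<open>a\<close> and \<open>b\<close> and the shifted arguments have room.\<close>
  have "\<exists>F. \<forall>x\<in>{a - 1..b + 1}. (F has_vector_derivative f x) (at x within {a - 1..b + 1})"
    using antiderivative_continuous[OF continuous_on_subset[OF cont], of "a - 1" "b + 1"]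
    by (metis subset_UNIV)
  then obtain F where F: "\<And>x. x \<in> {a - 1..b + 1} \<Longrightarrow> (F has_vector_derivative f x) (at x within {a - 1..b + 1})"
    by blast
  have F_at: "(F has_real_derivative f x) (at x)" if "a - 1 < x" "x < b + 1" for x
    using F[of x] that at_within_interior[of x "{a - 1..b + 1}"]
    by (simp add: has_real_derivative_iff_has_vector_derivative)
  have quot: "(\<lambda>k. (F (x + 1 / real (Suc k)) - F x) * real (Suc k)) \<longlonglongrightarrow> f x" if "a - 1 < x" "x < b + 1" for x
  proof -
    have "((\<lambda>h. (F (x + h) - F x) / h) \<longlongrightarrow> f x) (at 0)"
      using F_at[OF that] unfolding DERIV_def .
    moreover have "filterlim (\<lambda>k. 1 / real (Suc k)) (at 0) sequentially"
      using LIMSEQ_inverse_real_of_nat by (auto simp: filterlim_at inverse_eq_divide)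
    ultimately show ?thesis
      by (auto dest: filterlim_compose)
  qed
  \<comment> \<open>The sequence is shifted by one index because the step must be below 1 for
    \<open>x + h\<close> to stay inside the open interval.\<close>
  have "integral {a..b} (\<lambda>x. (f (x + 1 / real (Suc (Suc k))) - f x) * real (Suc (Suc k)))
      = (F (b + 1 / real (Suc (Suc k))) - F b) * real (Suc (Suc k)) -
        (F (a + 1 / real (Suc (Suc k))) - F a) * real (Suc (Suc k))" for k
  proof -
    define h where "h = 1 / real (Suc (Suc k))"
    have h: "0 < h" "h < 1" by (auto simp: h_def divide_simps)
    have "((\<lambda>x. (F (x + h) - F x) * real (Suc (Suc k))) has_vector_derivative
             (f (x + h) - f x) * real (Suc (Suc k))) (at x within {a..b})" if "x \<in> {a..b}" for x
    proof -
      have "((\<lambda>x. F (x + h)) has_real_derivative f (x + h)) (at x)"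
        using F_at[of "x + h"] that h by (simp add: DERIV_shift)
      moreover have "(F has_real_derivative f x) (at x)"
        using F_at that h by simp
      ultimately have "((\<lambda>x. (F (x + h) - F x) * real (Suc (Suc k))) has_real_derivative
             (f (x + h) - f x) * real (Suc (Suc k))) (at x)"
        by (intro DERIV_cmult_right DERIV_diff)
      then show ?thesis
        using has_field_derivative_at_within has_real_derivative_iff_has_vector_derivative by blast
    qed
    from fundamental_theorem_of_calculus[OF \<open>a \<le> b\<close> this]
    show ?thesis unfolding h_def by (intro integral_unique) (auto simp: algebra_simps)
  qed
  moreover have "(\<lambda>k. (F (b + 1 / real (Suc (Suc k))) - F b) * real (Suc (Suc k)) -
        (F (a + 1 / real (Suc (Suc k))) - F a) * real (Suc (Suc k))) \<longlonglongrightarrow> f b - f a"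
    using assms by (intro tendsto_diff LIMSEQ_Suc[OF quot]) auto
  ultimately show ?thesis
    by (subst filterlim_sequentially_Suc[symmetric]) simp
qed

text \<open>The divergence theorem for a field whose divergence exists, and vanishes, only off the
  null set \<open>N\<close>. Fubini and the preceding limit turn integrals of difference quotients
  into the boundary terms; the Lipschitz bounds dominate the quotients, whose sum tends to 0 off
  \<open>N\<close>.\<close>

lemma flux_over_rectangle_zero:
  fixes G H :: "real \<Rightarrow> real \<Rightarrow> real"
  assumes contG: "continuous_on UNIV (\<lambda>(x, y). G x y)" and contH: "continuous_on UNIV (\<lambda>(x, y). H x y)"
    and lipG: "\<And>x y h. x \<in> {a..b} \<Longrightarrow> y \<in> {c..d} \<Longrightarrow> 0 < h \<Longrightarrow> h \<le> 1 \<Longrightarrow> \<bar>G (x + h) y - G x y\<bar> \<le> L * h"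
    and lipH: "\<And>x y h. x \<in> {a..b} \<Longrightarrow> y \<in> {c..d} \<Longrightarrow> 0 < h \<Longrightarrow> h \<le> 1 \<Longrightarrow> \<bar>H x (y + h) - H x y\<bar> \<le> L * h"
    and N: "negligible N"
    and div: "\<And>x y. x \<in> {a..b} \<Longrightarrow> y \<in> {c..d} \<Longrightarrow> (x, y) \<notin> N \<Longrightarrow>
      \<exists>A. ((\<lambda>t. G t y) has_real_derivative A) (at x) \<and> ((\<lambda>t. H x t) has_real_derivative - A) (at y)"
    and "a \<le> b" "c \<le> d"
  shows "integral {c..d} (G b) - integral {c..d} (G a) +
    (integral {a..b} (\<lambda>x. H x d) - integral {a..b} (\<lambda>x. H x c)) = 0"
proof -
  define h where "h = (\<lambda>k. 1 / real (Suc k))"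
  have h: "0 < h k" "h k \<le> 1" "h k * real (Suc k) = 1" for k
    by (auto simp: h_def divide_simps)
  have hlim: "filterlim h (at 0) sequentially"
    using LIMSEQ_inverse_real_of_nat by (auto simp: filterlim_at inverse_eq_divide h_def)
  define B where "B = cbox (a, c) (b, d)"
  have contG': "continuous_on S (\<lambda>z. G (p z) (q z))" if "continuous_on S p" "continuous_on S q" for S :: "'z::topological_space set" and p q
    using continuous_on_compose2[OF contG, of S "\<lambda>z. (p z, q z)"] that by (auto intro: continuous_intros)
  have contH': "continuous_on S (\<lambda>z. H (p z) (q z))" if "continuous_on S p" "continuous_on S q" for S :: "'z::topological_space set" and p q
    using continuous_on_compose2[OF contH, of S "\<lambda>z. (p z, q z)"] that by (auto intro: continuous_intros)
  define g1 where "g1 = (\<lambda>k z. (G (fst z + h k) (snd z) - G (fst z) (snd z)) * real (Suc k))"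
  define g2 where "g2 = (\<lambda>k z. (H (fst z) (snd z + h k) - H (fst z) (snd z)) * real (Suc k))"
  have cont1: "continuous_on S (g1 k)" and cont2: "continuous_on S (g2 k)" for k S
    unfolding g1_def g2_def by (intro continuous_intros contG' contH')+
  have int1: "integral B (g1 k) = integral {a..b} (\<lambda>x. (integral {c..d} (G (x + h k)) - integral {c..d} (G x)) * real (Suc k))" for k
  proof -
    have "integral B (g1 k) = integral {a..b} (\<lambda>x. integral {c..d} (\<lambda>y. g1 k (x, y)))"
      unfolding B_def using integral_prod_continuous[OF cont1] by simp
    also have "\<dots> = integral {a..b} (\<lambda>x. (integral {c..d} (G (x + h k)) - integral {c..d} (G x)) * real (Suc k))"
      unfolding g1_def
      by (intro integral_cong, simp, subst integral_diff)
        (auto intro!: integrable_continuous_interval contG' continuous_intros)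
    finally show ?thesis .
  qed
  have int2: "integral B (g2 k) = integral {c..d} (\<lambda>y. (integral {a..b} (\<lambda>x. H x (y + h k)) - integral {a..b} (\<lambda>x. H x y)) * real (Suc k))" for k
  proof -
    have "integral B (g2 k) = integral {a..b} (\<lambda>x. integral {c..d} (\<lambda>y. g2 k (x, y)))"
      unfolding B_def using integral_prod_continuous[OF cont2] by simp
    also have "\<dots> = integral {c..d} (\<lambda>y. integral {a..b} (\<lambda>x. g2 k (x, y)))"
      using integral_swap_continuous[of a c b d "\<lambda>x y. g2 k (x, y)"] cont2[of _ k]
      by (simp add: case_prod_unfold)
    also have "\<dots> = integral {c..d} (\<lambda>y. (integral {a..b} (\<lambda>x. H x (y + h k)) - integral {a..b} (\<lambda>x. H x y)) * real (Suc k))"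
      unfolding g2_def
      by (intro integral_cong, simp, subst integral_diff)
        (auto intro!: integrable_continuous_interval contH' continuous_intros)
    finally show ?thesis .
  qed
  have par1: "continuous_on UNIV (\<lambda>x. integral {c..d} (G x))"
    using integral_continuous_on_param[of UNIV c d G] continuous_on_subset[OF contG] by auto
  have par2: "continuous_on UNIV (\<lambda>y. integral {a..b} (\<lambda>x. H x y))"
    using integral_continuous_on_param[of UNIV a b "\<lambda>y x. H x y"]
      contH'[of "UNIV \<times> cbox a b" snd fst]
    by (simp add: case_prod_unfold continuous_on_fst continuous_on_snd continuous_on_id)
  have lim1: "(\<lambda>k. integral B (g1 k)) \<longlonglongrightarrow> integral {c..d} (G b) - integral {c..d} (G a)"
    unfolding int1 h_def by (rule integral_difference_quotient_tendsto[OF par1 \<open>a \<le> b\<close>])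
  have lim2: "(\<lambda>k. integral B (g2 k)) \<longlonglongrightarrow> integral {a..b} (\<lambda>x. H x d) - integral {a..b} (\<lambda>x. H x c)"
    unfolding int2 h_def by (rule integral_difference_quotient_tendsto[OF par2 \<open>c \<le> d\<close>])
  define g where "g = (\<lambda>k z. g1 k z + g2 k z)"
  have gint: "g k integrable_on B" for k
    unfolding B_def g_def by (intro integrable_continuous continuous_intros cont1 cont2)
  have "(\<lambda>k. integral B (g k)) \<longlonglongrightarrow> integral {c..d} (G b) - integral {c..d} (G a) +
    (integral {a..b} (\<lambda>x. H x d) - integral {a..b} (\<lambda>x. H x c))"
  proof -
    have "integral B (g k) = integral B (g1 k) + integral B (g2 k)" for k
      unfolding g_def B_def by (intro integral_add integrable_continuous cont1 cont2)
    then show ?thesis using tendsto_add[OF lim1 lim2] by simp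
  qed
  moreover have "(\<lambda>k. integral B (g k)) \<longlonglongrightarrow> 0"
  proof -
    have neg: "negligible {x \<in> (B - N) - B. f x \<noteq> 0}" "negligible {x \<in> B - (B - N). f x \<noteq> 0}" for f :: "real \<times> real \<Rightarrow> real"
      by (auto intro: negligible_subset[OF N])
    have "(\<lambda>k. integral (B - N) (g k)) \<longlonglongrightarrow> integral (B - N) (\<lambda>_. 0)"
    proof (rule dominated_convergence)
      show "g k integrable_on (B - N)" for k
        using integrable_spike_set[OF gint neg(2,1)] by blast
      show "(\<lambda>_. 2 * L) integrable_on (B - N)"
        by (rule integrable_spike_set[OF _ neg(2,1)]) (auto simp: B_def)
      show "norm (g k z) \<le> 2 * L" if zB: "z \<in> B - N" for k z
      proof -
        obtain x y where z: "z = (x, y)" "x \<in> {a..b}" "y \<in> {c..d}"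
          using zB by (cases z) (auto simp: B_def cbox_Pair_eq)
        have "\<bar>(G (x + h k) y - G x y) * real (Suc k)\<bar> \<le> (L * h k) * real (Suc k)"
          using mult_right_mono[OF lipG[OF z(2,3) h(1,2)], of "real (Suc k)" k] by (simp add: abs_mult)
        moreover have "\<bar>(H x (y + h k) - H x y) * real (Suc k)\<bar> \<le> (L * h k) * real (Suc k)"
          using mult_right_mono[OF lipH[OF z(2,3) h(1,2)], of "real (Suc k)" k] by (simp add: abs_mult)
        moreover have "(L * h k) * real (Suc k) = L"
          using h(3)[of k] by (simp only: mult.assoc mult_1_right)
        ultimately have "\<bar>(G (x + h k) y - G x y) * real (Suc k) + (H x (y + h k) - H x y) * real (Suc k)\<bar> \<le> 2 * L"
          by linarith
        then show ?thesis by (simp only: g_def g1_def g2_def z fst_conv snd_conv real_norm_def)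
      qed
      show "(\<lambda>k. g k z) \<longlonglongrightarrow> 0" if zB: "z \<in> B - N" for z
      proof -
        obtain x y where z: "z = (x, y)" "x \<in> {a..b}" "y \<in> {c..d}" "(x, y) \<notin> N"
          using zB by (cases z) (auto simp: B_def cbox_Pair_eq)
        from div[OF z(2-4)] obtain A where
          A: "((\<lambda>t. G t y) has_real_derivative A) (at x)" "((\<lambda>t. H x t) has_real_derivative - A) (at y)"
          by blast
        have "(\<lambda>k. (G (x + h k) y - G x y) / h k) \<longlonglongrightarrow> A"
          using filterlim_compose[OF A(1)[unfolded DERIV_def] hlim] .
        moreover have "(\<lambda>k. (H x (y + h k) - H x y) / h k) \<longlonglongrightarrow> - A"
          using filterlim_compose[OF A(2)[unfolded DERIV_def] hlim] .
        ultimately have "(\<lambda>k. (G (x + h k) y - G x y) / h k + (H x (y + h k) - H x y) / h k) \<longlonglongrightarrow> A + - A"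
          by (rule tendsto_add)
        then show ?thesis by (simp add: g_def g1_def g2_def z h_def)
      qed
    qed
    moreover have "integral (B - N) (g k) = integral B (g k)" for k
      by (rule integral_spike_set[OF neg])
    ultimately show ?thesis by simp
  qed
  ultimately show ?thesis by (rule LIMSEQ_unique)
qed

text \<open>\<open>(G, H)\<close> is the gradient of \<open>U\<close>. Zero flux makes the form - H
  dx + G dy exact on small squares; its potential \<open>v\<close> is the harmonic conjugate of
  \<open>U\<close>, so \<open>U\<close> + i \<open>v\<close> satisfies the Cauchy-Riemann equations
  and has derivative G - i H, which is holomorphic as the derivative of a holomorphic
  function.\<close>

lemma holomorphic_gradient:
  fixes G H :: "real \<Rightarrow> real \<Rightarrow> real" and U :: "complex \<Rightarrow> real"
  assumes contG: "continuous_on UNIV (\<lambda>(x, y). G x y)" and contH: "continuous_on UNIV (\<lambda>(x, y). H x y)"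
    and "open D"
    and flux: "\<And>a b c d. a \<le> b \<Longrightarrow> c \<le> d \<Longrightarrow> (\<And>x y. x \<in> {a..b} \<Longrightarrow> y \<in> {c..d} \<Longrightarrow> Complex x y \<in> D) \<Longrightarrow>
      integral {c..d} (G b) - integral {c..d} (G a) +
        (integral {a..b} (\<lambda>x. H x d) - integral {a..b} (\<lambda>x. H x c)) = 0"
    and U: "\<And>z. (U has_derivative (\<lambda>h. G (Re z) (Im z) * Re h + H (Re z) (Im z) * Im h)) (at z)"
  shows "(\<lambda>z. Complex (G (Re z) (Im z)) (- H (Re z) (Im z))) holomorphic_on D"
proof -
  let ?f = "\<lambda>z. Complex (G (Re z) (Im z)) (- H (Re z) (Im z))"
  have "\<exists>E. open E \<and> w \<in> E \<and> ?f holomorphic_on E" if wD: "w \<in> D" for w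
  proof -
    obtain r where r: "r > 0" "ball w r \<subseteq> D"
      using \<open>open D\<close> wD by (meson open_contains_ball)
    \<comment> \<open>Points of the square of half-side \<open>r / 3\<close> have distance at most 2
      r / 3 from \<open>w\<close> in the 1-norm, so the square stays in the ball.\<close>
    define e where "e = r / 3"
    have "e > 0" using r by (simp add: e_def)
    define x0 y0 x1 y1 where "x0 = Re w - e" and "y0 = Im w - e" and "x1 = Re w + e" and "y1 = Im w + e"
    note defs = x0_def y0_def x1_def y1_def
    have inD: "Complex x y \<in> D" if "x \<in> {x0..x1}" "y \<in> {y0..y1}" for x y
    proof -
      have "norm (w - Complex x y) \<le> \<bar>Re w - x\<bar> + \<bar>Im w - y\<bar>"
        using cmod_le[of "w - Complex x y"] by simp
      also have "\<dots> < r" using that r by (auto simp: defs e_def)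
      finally show ?thesis using r by (auto simp: dist_norm)
    qed
    \<comment> \<open>\<open>v\<close> integrates along the bottom edge and then upwards; by zero
      flux, \<open>v_alt\<close> integrates up the left edge and then across. Each form makes one
      partial derivative immediate.\<close>
    define v where "v x y = integral {y0..y} (G x) - integral {x0..x} (\<lambda>t. H t y0)" for x y
    have v_alt: "v x y = integral {y0..y} (G x0) - integral {x0..x} (\<lambda>t. H t y)"
      if "x \<in> {x0..x1}" "y \<in> {y0..y1}" for x y
      using flux[of x0 x y0 y] that inD by (auto simp: v_def)
    have contG_y: "continuous_on A (G x)" for x A
      using continuous_on_compose2[OF contG, of A "\<lambda>y. (x, y)"] by (simp add: continuous_on_Pair)
    have contH_x: "continuous_on A (\<lambda>x. H x y)" for y A
      using continuous_on_compose2[OF contH, of A "\<lambda>x. (x, y)"] by (simp add: continuous_on_Pair)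
    have v_y: "((\<lambda>y. v x y) has_derivative blinfun_apply (blinfun_scaleR_left (G x y))) (at y within {y0..y1})"
      if "x \<in> {x0..x1}" "y \<in> {y0..y1}" for x y
    proof -
      have "((\<lambda>y. integral {y0..y} (G x)) has_vector_derivative G x y) (at y within {y0..y1})"
        by (rule integral_has_vector_derivative[OF contG_y that(2)])
      then have "((\<lambda>y. v x y) has_vector_derivative G x y) (at y within {y0..y1})"
        unfolding v_def by (auto intro!: derivative_eq_intros)
      then show ?thesis
        by (simp add: has_vector_derivative_def)
    qed
    have v_x: "((\<lambda>x. v x y) has_derivative (\<lambda>h. h * - H x y)) (at x within {x0..x1})"
      if "x \<in> {x0..x1}" "y \<in> {y0..y1}" for x y
    proof -
      have "((\<lambda>x. integral {x0..x} (\<lambda>t. H t y)) has_vector_derivative H x y) (at x within {x0..x1})"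
        by (rule integral_has_vector_derivative[OF contH_x that(1)])
      then have "((\<lambda>x. integral {y0..y} (G x0) - integral {x0..x} (\<lambda>t. H t y)) has_vector_derivative - H x y)
          (at x within {x0..x1})"
        by (auto intro!: derivative_eq_intros)
      then have "((\<lambda>x. v x y) has_vector_derivative - H x y) (at x within {x0..x1})"
        by (rule has_vector_derivative_transform[rotated 2]) (use that v_alt in auto)
      then show ?thesis
        by (simp add: has_vector_derivative_def)
    qed
    have v_der: "((\<lambda>(x, y). v x y) has_derivative (\<lambda>(s, t). s * - H x y + t * G x y)) (at (x, y))"
      if "x \<in> {x0<..<x1}" "y \<in> {y0<..<y1}" for x y
    proof -
      \<comment> \<open>Partial derivatives alone do not give joint differentiability; the
        continuity of the derivative in \<open>y\<close> supplies it.\<close>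
      have "continuous (at (x, y) within {x0..x1} \<times> {y0..y1}) (\<lambda>(x, y). blinfun_scaleR_left (G x y) :: real \<Rightarrow>\<^sub>L real)"
      proof -
        have "isCont (\<lambda>z. G (fst z) (snd z)) (x, y)"
          using contG by (simp add: continuous_on_eq_continuous_at case_prod_unfold)
        then have "continuous (at (x, y) within {x0..x1} \<times> {y0..y1}) (\<lambda>z. G (fst z) (snd z))"
          by (rule continuous_at_imp_continuous_at_within)
        from bounded_linear.continuous[OF bounded_linear_blinfun_scaleR_left this]
        show ?thesis by (simp add: case_prod_unfold)
      qed
      then have "((\<lambda>(x, y). v x y) has_derivative (\<lambda>(s, t). s * - H x y + blinfun_apply (blinfun_scaleR_left (G x y)) t))
          (at (x, y) within {x0..x1} \<times> {y0..y1})"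
        by (intro has_derivative_partialsI[where f = v and fx = "\<lambda>s. s * - H x y"
              and fy = "\<lambda>x y. blinfun_scaleR_left (G x y)"] v_x v_y) (use that in simp_all)
      moreover have "at (x, y) within {x0..x1} \<times> {y0..y1} = at (x, y)"
        by (rule at_within_interior) (use that in \<open>simp add: interior_Times\<close>)
      ultimately show ?thesis by simp
    qed
    define E where "E = {z. Re z \<in> {x0<..<x1} \<and> Im z \<in> {y0<..<y1}}"
    define F where "F z = Complex (U z) (v (Re z) (Im z))" for z
    have "E = box (Complex x0 y0) (Complex x1 y1)"
      by (auto simp: E_def box_def Basis_complex_def)
    then have "open E" by (simp add: open_box)
    have F: "(F has_field_derivative ?f z) (at z)" if "z \<in> E" for z
    proof -
      have "((\<lambda>z. (\<lambda>(x, y). v x y) (Re z, Im z)) has_derivative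
          (\<lambda>h. (\<lambda>(s, t). s * - H (Re z) (Im z) + t * G (Re z) (Im z)) (Re h, Im h))) (at z)"
        by (rule has_derivative_compose[where f = "\<lambda>z. (Re z, Im z)"])
          (use that v_der[of "Re z" "Im z"] in \<open>auto simp: E_def intro!: derivative_eq_intros\<close>)
      then have "((\<lambda>z. of_real (U z) + \<i> * of_real (v (Re z) (Im z))) has_derivative
          (\<lambda>h. of_real (G (Re z) (Im z) * Re h + H (Re z) (Im z) * Im h) +
            \<i> * of_real (Re h * - H (Re z) (Im z) + Im h * G (Re z) (Im z)))) (at z)"
        by (intro has_derivative_add has_derivative_mult_right has_derivative_of_real U) auto
      then show ?thesis
        unfolding has_field_derivative_def F_def Complex_eq[symmetric]
        by (rule has_derivative_eq_rhs) (auto simp: fun_eq_iff complex_eq_iff algebra_simps)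
    qed
    then have "F holomorphic_on E"
      by (auto simp: holomorphic_on_open[OF \<open>open E\<close>])
    then have "deriv F holomorphic_on E"
      using \<open>open E\<close> by (rule holomorphic_deriv)
    then have "?f holomorphic_on E"
      by (rule holomorphic_transform) (use F in \<open>auto intro: DERIV_imp_deriv\<close>)
    moreover have "w \<in> E" using \<open>e > 0\<close> by (auto simp: E_def defs)
    ultimately show ?thesis using \<open>open E\<close> by blast
  qed
  then show ?thesis
    unfolding holomorphic_on_open[OF \<open>open D\<close>] by (metis holomorphic_on_open)
qed

section \<open>Gradients, coordinates and null sets in the plane\<close>

lemma gderiv_unique:
  assumes "GDERIV f x :> d" "GDERIV f x :> d'"
  shows "d = d'"
  using has_derivative_unique[OF assms[unfolded gderiv_def]]
  by (metis inner_commute vector_eq_rdot)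

text \<open>The gradient inside \<open>has_laplacian\<close> is existentially quantified. Uniqueness
  of gradients makes it agree near \<open>x\<close> with any gradient field \<open>g\<close> at
  hand, so the trace can be taken from the derivative of \<open>g\<close>.\<close>

lemma has_laplacian_gradient:
  assumes "has_laplacian u l x" and g: "\<forall>\<^sub>F y in nhds x. GDERIV u y :> g y"
  obtains H where "(g has_derivative H) (at x)" "l = (\<Sum>b\<in>Basis. H b \<bullet> b)"
proof -
  obtain g' H where g': "\<forall>\<^sub>F y in nhds x. GDERIV u y :> g' y" and H: "(g' has_derivative H) (at x)"
    and l: "l = (\<Sum>b\<in>Basis. H b \<bullet> b)"
    using assms(1) unfolding has_laplacian_def by blast
  have ev: "\<forall>\<^sub>F y in nhds x. g' y = g y"
    using g g' by eventually_elim (rule gderiv_unique)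
  have "(g has_derivative H) (at x)"
  proof (rule has_derivative_transform_eventually[OF H])
    show "\<forall>\<^sub>F y in at x. g' y = g y"
      using ev by (auto simp: eventually_at_filter elim: eventually_mono)
    show "g' x = g x" using ev by (rule eventually_nhds_x_imp_x)
  qed auto
  then show thesis using l that by blast
qed

lemma Basis_real2: "(Basis :: (real^2) set) = {axis 1 1, axis 2 1}"
  by (auto simp: Basis_vec_def UNIV_2)

lemma sum_Basis_real2: "(\<Sum>b\<in>(Basis :: (real^2) set). f b) = f (axis 1 1) + f (axis 2 1)"
  unfolding Basis_real2 by (subst sum.insert) (auto simp: axis_eq_axis)

lemma inner_real2: "(x :: real^2) \<bullet> y = x $ 1 * y $ 1 + x $ 2 * y $ 2"
  by (simp add: inner_vec_def sum_2)

lemma vector2_eqI: "(x :: 'a^2) $ 1 = y $ 1 \<Longrightarrow> x $ 2 = y $ 2 \<Longrightarrow> x = y"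
  by (simp add: vec_eq_iff forall_2)

lemma vector2_decomp: "(vector [s, t] :: real^2) = s *\<^sub>R axis 1 1 + t *\<^sub>R axis 2 1"
  by (intro vector2_eqI) (auto simp: axis_def)

lemma has_derivative_vector2:
  assumes "(f has_derivative f') F" "(g has_derivative g') F"
  shows "((\<lambda>x. vector [f x, g x] :: real^2) has_derivative (\<lambda>h. vector [f' h, g' h])) F"
  unfolding vector2_decomp using assms by (auto intro!: derivative_eq_intros)

lemma lebesgue_AE_negligible:
  assumes "AE x in lebesgue. P x"
  shows "negligible {x :: 'a::euclidean_space. \<not> P x}"
  using assms by (simp add: AE_iff_null_sets negligible_iff_null_sets completion.AE_iff_null_sets)

lemma negligible_AE_lebesgue:
  assumes "negligible {x :: 'a::euclidean_space. \<not> P x}"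
  shows "AE x in lebesgue. P x"
  using assms by (simp add: AE_iff_null_sets negligible_iff_null_sets completion.AE_iff_null_sets)

lemma AE_off_hyperplane:
  fixes n :: "'a::euclidean_space"
  assumes "n \<noteq> 0"
  shows "AE x in lebesgue. x \<bullet> n \<noteq> 0"
proof (rule negligible_AE_lebesgue)
  have "{x. \<not> x \<bullet> n \<noteq> 0} = {x. n \<bullet> x = 0}" by (simp add: inner_commute)
  then show "negligible {x. \<not> x \<bullet> n \<noteq> 0}" using assms negligible_hyperplane[of n 0] by simp
qed

text \<open>The conjugate gradient vanishes on \<open>S\<close>, hence on all of \<open>D\<close> by
  the identity theorem. Convexity of \<open>D\<close> gives the connectedness for this and then
  makes \<open>V\<close> constant, with the value 0 that it has on \<open>S\<close>.\<close>

proposition unique_continuation: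
  fixes V :: "real^2 \<Rightarrow> real"
  assumes "C11_loc V" and lap: "AE x in lebesgue. x \<in> D \<longrightarrow> has_laplacian V 0 x"
    and "open D" "convex D" "open S" "S \<subseteq> D" "S \<noteq> {}"
    and S0: "\<And>x. x \<in> S \<Longrightarrow> V x = 0" and "x \<in> D"
  shows "V x = 0"
proof -
  obtain g where g: "\<And>x. GDERIV V x :> g x" and lip: "\<And>K. compact K \<Longrightarrow> \<exists>L. L-lipschitz_on K g"
    using assms(1) unfolding C11_loc_def by blast
  define T where "T z = (vector [Re z, Im z] :: real^2)" for z
  have T_der: "(T has_derivative T) (at z)" for z
    unfolding T_def by (intro has_derivative_vector2 derivative_eq_intros) auto
  have contT: "continuous_on A T" for A
    using T_der has_derivative_continuous continuous_at_imp_continuous_on by blast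
  have "isCont g x" for x
  proof -
    obtain L where "L-lipschitz_on (cball x 1) g" using lip[OF compact_cball] by blast
    then have "continuous_on (cball x 1) g" by (rule lipschitz_on_continuous_on)
    then show ?thesis by (rule continuous_on_interior) (simp add: interior_cball)
  qed
  then have contg: "continuous_on A g" for A
    by (simp add: continuous_at_imp_continuous_on)
  define G H where "G = (\<lambda>x y. g (vector [x, y]) $ 1)" and "H = (\<lambda>x y. g (vector [x, y]) $ 2)"
  have cont_vec: "continuous_on UNIV (\<lambda>z. vector [fst z, snd z] :: real^2)"
    unfolding vector2_decomp by (intro continuous_intros)
  have contG: "continuous_on UNIV (\<lambda>(x, y). G x y)" and contH: "continuous_on UNIV (\<lambda>(x, y). H x y)"
    unfolding G_def H_def case_prod_unfold
    by (rule continuous_on_component[OF continuous_on_compose2[OF contg[of UNIV] cont_vec]], simp)+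
  \<comment> \<open>The exceptional set is moved to pairs of reals, where the flux lemma lives; a
    linear map between spaces of equal dimension keeps it negligible.\<close>
  define N where "N = (\<lambda>x. (x $ 1, x $ 2)) ` {x. \<not> (x \<in> D \<longrightarrow> has_laplacian V 0 x)}"
  have "negligible N"
    unfolding N_def
  proof (rule negligible_differentiable_image_negligible)
    show "negligible {x. \<not> (x \<in> D \<longrightarrow> has_laplacian V 0 x)}"
      by (rule lebesgue_AE_negligible[OF lap])
    show "(\<lambda>x::real^2. (x $ 1, x $ 2)) differentiable_on {x. \<not> (x \<in> D \<longrightarrow> has_laplacian V 0 x)}"
      by (intro linear_imp_differentiable_on linearI) auto
  qed simp
  define D' where "D' = T -` D"
  have "open D'" unfolding D'_def using contT \<open>open D\<close> by (simp add: open_vimage)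
  have "linear T" using T_der has_derivative_linear by blast
  have "convex D'" unfolding D'_def using \<open>linear T\<close> \<open>convex D\<close> by (rule convex_linear_vimage)
  have surjT: "T (Complex (x $ 1) (x $ 2)) = x" for x
    by (intro vector2_eqI) (auto simp: T_def)
  have div: "\<exists>A. ((\<lambda>t. G t y) has_real_derivative A) (at x) \<and> ((\<lambda>t. H x t) has_real_derivative - A) (at y)"
    if "Complex x y \<in> D'" "(x, y) \<notin> N" for x y
  proof -
    let ?p = "vector [x, y] :: real^2"
    have "?p \<in> D" using that by (simp add: D'_def T_def)
    moreover have "(x, y) = (?p $ 1, ?p $ 2)" by simp
    ultimately have "has_laplacian V 0 ?p"
      using that(2) unfolding N_def by blast
    then obtain K where K: "(g has_derivative K) (at ?p)" "0 = (\<Sum>b\<in>Basis. K b \<bullet> b)"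
      using has_laplacian_gradient[of V 0 ?p g] g by (auto simp: eventually_at_topological)
    interpret K: bounded_linear K using K(1) by (rule has_derivative_bounded_linear)
    have tr: "K (axis 1 1) $ 1 + K (axis 2 1) $ 2 = 0"
      using K(2) by (simp add: sum_Basis_real2 inner_axis)
    have "((\<lambda>t. vector [t, y] :: real^2) has_derivative (\<lambda>h. vector [h, 0])) (at x)"
      by (intro has_derivative_vector2 derivative_intros)
    from has_derivative_compose[OF this K(1)]
    have "((\<lambda>t. g (vector [t, y])) has_derivative (\<lambda>h. K (vector [h, 0]))) (at x)" .
    then have "((\<lambda>t. G t y) has_derivative (\<lambda>h. K (vector [h, 0]) $ 1)) (at x)"
      unfolding G_def by (rule bounded_linear.has_derivative[OF bounded_linear_vec_nth])
    moreover have "K (vector [h, 0]) $ 1 = K (axis 1 1) $ 1 * h" for h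
      by (simp add: vector2_decomp K.scaleR)
    ultimately have 1: "((\<lambda>t. G t y) has_real_derivative K (axis 1 1) $ 1) (at x)"
      by (simp add: has_field_derivative_def)
    have "((\<lambda>t. vector [x, t] :: real^2) has_derivative (\<lambda>h. vector [0, h])) (at y)"
      by (intro has_derivative_vector2 derivative_intros)
    from has_derivative_compose[OF this K(1)]
    have "((\<lambda>t. g (vector [x, t])) has_derivative (\<lambda>h. K (vector [0, h]))) (at y)" .
    then have "((\<lambda>t. H x t) has_derivative (\<lambda>h. K (vector [0, h]) $ 2)) (at y)"
      unfolding H_def by (rule bounded_linear.has_derivative[OF bounded_linear_vec_nth])
    moreover have "K (vector [0, h]) $ 2 = K (axis 2 1) $ 2 * h" for h
      by (simp add: vector2_decomp K.scaleR)
    ultimately have "((\<lambda>t. H x t) has_real_derivative K (axis 2 1) $ 2) (at y)"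
      by (simp add: has_field_derivative_def)
    moreover have "K (axis 2 1) $ 2 = - (K (axis 1 1) $ 1)" using tr by simp
    ultimately show ?thesis using 1 by auto
  qed
  have flux: "integral {c..d} (G b) - integral {c..d} (G a) +
        (integral {a..b} (\<lambda>x. H x d) - integral {a..b} (\<lambda>x. H x c)) = 0"
    if "a \<le> b" "c \<le> d" and in_D': "\<And>x y. x \<in> {a..b} \<Longrightarrow> y \<in> {c..d} \<Longrightarrow> Complex x y \<in> D'" for a b c d
  proof -
    \<comment> \<open>The box exceeds the rectangle by 1 because the difference quotients use
      forward steps up to 1.\<close>
    let ?K = "cbox (vector [a, c]) (vector [b + 1, d + 1]) :: (real^2) set"
    obtain L where L: "L-lipschitz_on ?K g" using lip[OF compact_cbox] by blast
    have mem: "vector [s, t] \<in> ?K \<longleftrightarrow> s \<in> {a..b + 1} \<and> t \<in> {c..d + 1}" for s t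
      by (auto simp: mem_box_cart forall_2)
    have "\<bar>G (x + h) y - G x y\<bar> \<le> L * h" if "x \<in> {a..b}" "y \<in> {c..d}" "0 < h" "h \<le> 1" for x y h
    proof -
      have "dist (g (vector [x + h, y])) (g (vector [x, y])) \<le> L * dist (vector [x + h, y] :: real^2) (vector [x, y])"
        using that by (intro lipschitz_onD[OF L]) (auto simp: mem)
      moreover have "dist (vector [x + h, y] :: real^2) (vector [x, y]) = h"
        using that by (simp add: dist_vec_def L2_set_def sum_2 dist_real_def)
      moreover have "\<bar>(g (vector [x + h, y]) - g (vector [x, y])) $ 1\<bar> \<le> dist (g (vector [x + h, y])) (g (vector [x, y]))"
        unfolding dist_norm by (rule component_le_norm_cart)
      ultimately show ?thesis by (simp add: G_def)
    qed
    moreover have "\<bar>H x (y + h) - H x y\<bar> \<le> L * h" if "x \<in> {a..b}" "y \<in> {c..d}" "0 < h" "h \<le> 1" for x y h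
    proof -
      have "dist (g (vector [x, y + h])) (g (vector [x, y])) \<le> L * dist (vector [x, y + h] :: real^2) (vector [x, y])"
        using that by (intro lipschitz_onD[OF L]) (auto simp: mem)
      moreover have "dist (vector [x, y + h] :: real^2) (vector [x, y]) = h"
        using that by (simp add: dist_vec_def L2_set_def sum_2 dist_real_def)
      moreover have "\<bar>(g (vector [x, y + h]) - g (vector [x, y])) $ 2\<bar> \<le> dist (g (vector [x, y + h])) (g (vector [x, y]))"
        unfolding dist_norm by (rule component_le_norm_cart)
      ultimately show ?thesis by (simp add: H_def)
    qed
    ultimately show ?thesis
      using flux_over_rectangle_zero[OF contG contH _ _ \<open>negligible N\<close> _ that(1,2), of L] div in_D' by blast
  qed
  define U where "U z = V (T z)" for z
  have U: "(U has_derivative (\<lambda>h. G (Re z) (Im z) * Re h + H (Re z) (Im z) * Im h)) (at z)" for z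
  proof -
    have "(U has_derivative (\<lambda>h. T h \<bullet> g (T z))) (at z)"
      unfolding U_def using has_derivative_compose[OF T_der g[of "T z", unfolded gderiv_def]] .
    then show ?thesis
      by (rule has_derivative_eq_rhs) (auto simp: T_def G_def H_def inner_real2 fun_eq_iff)
  qed
  let ?f = "\<lambda>z. Complex (G (Re z) (Im z)) (- H (Re z) (Im z))"
  have hol: "?f holomorphic_on D'"
    by (rule holomorphic_gradient[OF contG contH \<open>open D'\<close> flux U]) auto
  define S' where "S' = T -` S"
  have S': "open S'" "S' \<subseteq> D'"
    unfolding S'_def D'_def using contT assms(5,6) by (auto simp: open_vimage)
  have "S' \<noteq> {}"
    unfolding S'_def using \<open>S \<noteq> {}\<close> surjT by (metis all_not_in_conv vimage_eq)
  have f_S': "?f z = 0" if "z \<in> S'" for z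
  proof -
    have "((\<lambda>_. 0) has_derivative (\<lambda>h. G (Re z) (Im z) * Re h + H (Re z) (Im z) * Im h)) (at z)"
      by (rule has_derivative_transform_within_open[OF U S'(1) that]) (auto simp: U_def S'_def S0)
    from has_derivative_unique[OF this has_derivative_const]
    have eq: "G (Re z) (Im z) * Re h + H (Re z) (Im z) * Im h = 0" for h by metis
    show ?thesis using eq[of 1] eq[of \<i>] by (simp add: complex_eq_iff)
  qed
  have f_D': "?f z = 0" if "z \<in> D'" for z
    using analytic_continuation_open[OF S'(1) \<open>open D'\<close> \<open>S' \<noteq> {}\<close> convex_connected[OF \<open>convex D'\<close>] S'(2) hol holomorphic_on_const[of 0]]
      f_S' that by blast
  have "\<exists>c. \<forall>z\<in>D'. U z = c"
  proof (rule has_derivative_zero_constant[OF \<open>convex D'\<close>])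
    fix z assume "z \<in> D'"
    with f_D'[of z] have "G (Re z) (Im z) = 0" "H (Re z) (Im z) = 0" by (auto simp: complex_eq_iff)
    then show "(U has_derivative (\<lambda>h. 0)) (at z within D')"
      using U[of z] by (simp add: has_derivative_at_withinI)
  qed
  moreover obtain z where "z \<in> S'" "z \<in> D'" using S' \<open>S' \<noteq> {}\<close> by blast
  moreover have "U z = 0" using \<open>z \<in> S'\<close> by (simp add: U_def S'_def S0)
  ultimately have "U (Complex (x $ 1) (x $ 2)) = 0"
    using \<open>x \<in> D\<close> by (metis D'_def surjT vimage_eq)
  then show ?thesis by (simp add: U_def surjT)
qed

section \<open>Calculus of gradients and Laplacians\<close>

lemma GDERIV_cmult: "GDERIV f x :> d \<Longrightarrow> GDERIV (\<lambda>x. c * f x) x :> c *\<^sub>R d"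
  unfolding gderiv_def by (auto intro!: derivative_eq_intros)

lemma has_laplacianI:
  assumes "\<forall>\<^sub>F y in nhds x. GDERIV u y :> g y" "(g has_derivative H) (at x)" "l = (\<Sum>b\<in>Basis. H b \<bullet> b)"
  shows "has_laplacian u l x"
  using assms unfolding has_laplacian_def by (intro exI[of _ g] exI[of _ H] conjI)

lemma C11_loc_add:
  assumes "C11_loc u" "C11_loc v"
  shows "C11_loc (\<lambda>x. u x + v x)"
proof -
  obtain g h where g: "\<And>x. GDERIV u x :> g x" "\<And>K. compact K \<Longrightarrow> \<exists>L. L-lipschitz_on K g"
    and h: "\<And>x. GDERIV v x :> h x" "\<And>K. compact K \<Longrightarrow> \<exists>L. L-lipschitz_on K h"
    using assms unfolding C11_loc_def by metis
  have "\<exists>L. L-lipschitz_on K (\<lambda>x. g x + h x)" if "compact K" for K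
    using g(2)[OF that] h(2)[OF that] lipschitz_on_add by blast
  then show ?thesis
    unfolding C11_loc_def by (intro exI[of _ "\<lambda>x. g x + h x"] conjI allI impI GDERIV_add g h)
qed

lemma C11_loc_cmult:
  assumes "C11_loc u"
  shows "C11_loc (\<lambda>x. c * u x)"
proof -
  obtain g where g: "\<And>x. GDERIV u x :> g x" "\<And>K. compact K \<Longrightarrow> \<exists>L. L-lipschitz_on K g"
    using assms unfolding C11_loc_def by metis
  have "\<exists>L. L-lipschitz_on K (\<lambda>x. c *\<^sub>R g x)" if "compact K" for K
    using g(2)[OF that] lipschitz_on_cmult by blast
  then show ?thesis
    unfolding C11_loc_def by (intro exI[of _ "\<lambda>x. c *\<^sub>R g x"] conjI allI impI GDERIV_cmult g)
qed

lemma has_laplacian_add: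
  assumes "has_laplacian u k x" "has_laplacian v l x"
  shows "has_laplacian (\<lambda>x. u x + v x) (k + l) x"
proof -
  obtain g G h H where g: "\<forall>\<^sub>F y in nhds x. GDERIV u y :> g y" "(g has_derivative G) (at x)" "k = (\<Sum>b\<in>Basis. G b \<bullet> b)"
    and h: "\<forall>\<^sub>F y in nhds x. GDERIV v y :> h y" "(h has_derivative H) (at x)" "l = (\<Sum>b\<in>Basis. H b \<bullet> b)"
    using assms unfolding has_laplacian_def by blast
  have "\<forall>\<^sub>F y in nhds x. GDERIV (\<lambda>x. u x + v x) y :> g y + h y"
    using g(1) h(1) by eventually_elim (rule GDERIV_add)
  moreover have "((\<lambda>y. g y + h y) has_derivative (\<lambda>y. G y + H y)) (at x)"
    using g(2) h(2) by (rule has_derivative_add)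
  moreover have "k + l = (\<Sum>b\<in>Basis. (G b + H b) \<bullet> b)"
    by (simp add: g h sum.distrib inner_add_left)
  ultimately show ?thesis by (rule has_laplacianI)
qed

lemma has_laplacian_cmult:
  assumes "has_laplacian u l x"
  shows "has_laplacian (\<lambda>x. c * u x) (c * l) x"
proof -
  obtain g G where g: "\<forall>\<^sub>F y in nhds x. GDERIV u y :> g y" "(g has_derivative G) (at x)" "l = (\<Sum>b\<in>Basis. G b \<bullet> b)"
    using assms unfolding has_laplacian_def by blast
  have "\<forall>\<^sub>F y in nhds x. GDERIV (\<lambda>x. c * u x) y :> c *\<^sub>R g y"
    using g(1) by eventually_elim (rule GDERIV_cmult)
  moreover have "((\<lambda>y. c *\<^sub>R g y) has_derivative (\<lambda>y. c *\<^sub>R G y)) (at x)"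
    using g(2) by (rule has_derivative_scaleR_right)
  moreover have "c * l = (\<Sum>b\<in>Basis. (c *\<^sub>R G b) \<bullet> b)"
    by (simp add: g sum_distrib_left)
  ultimately show ?thesis by (rule has_laplacianI)
qed

lemma has_laplacian_unique:
  assumes "has_laplacian u k x" "has_laplacian u l x"
  shows "k = l"
proof -
  obtain g H where g: "\<forall>\<^sub>F y in nhds x. GDERIV u y :> g y" "(g has_derivative H) (at x)" "k = (\<Sum>b\<in>Basis. H b \<bullet> b)"
    using assms(1) unfolding has_laplacian_def by blast
  obtain K where "(g has_derivative K) (at x)" "l = (\<Sum>b\<in>Basis. K b \<bullet> b)"
    using has_laplacian_gradient[OF assms(2) g(1)] .
  then show ?thesis using has_derivative_unique[OF g(2)] g(3) by metis
qed

lemma laplacian_eqI: "has_laplacian u l x \<Longrightarrow> laplacian u x = l"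
  unfolding laplacian_def by (auto intro: has_laplacian_unique)

lemma has_laplacian_transform:
  assumes "has_laplacian u l x" and "\<forall>\<^sub>F y in nhds x. u y = v y"
  shows "has_laplacian v l x"
proof -
  obtain g H where g: "\<forall>\<^sub>F y in nhds x. GDERIV u y :> g y" "(g has_derivative H) (at x)" "l = (\<Sum>b\<in>Basis. H b \<bullet> b)"
    using assms(1) unfolding has_laplacian_def by blast
  \<comment> \<open>Agreement near \<open>x\<close> is also agreement near each point close to
    \<open>x\<close>, and the gradients at these points depend on that.\<close>
  have "\<forall>\<^sub>F y in nhds x. \<forall>\<^sub>F z in nhds y. u z = v z"
    using assms(2) by (simp add: eventually_eventually)
  with g(1) have "\<forall>\<^sub>F y in nhds x. GDERIV v y :> g y"
  proof eventually_elim
    case (elim y)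
    then show ?case
      unfolding gderiv_def
      by (auto intro!: has_derivative_transform_eventually[where f = u] eventually_nhds_x_imp_x[where P = "\<lambda>z. u z = v z"]
          simp: eventually_at_filter elim: eventually_mono)
  qed
  then show ?thesis using g(2,3) by (rule has_laplacianI)
qed

lemma has_laplacian_open_transform:
  assumes "has_laplacian u l x" "open A" "x \<in> A" "\<And>y. y \<in> A \<Longrightarrow> u y = v y"
  shows "has_laplacian v l x"
  using assms(1)
proof (rule has_laplacian_transform)
  show "\<forall>\<^sub>F y in nhds x. u y = v y"
    using eventually_nhds_in_open[OF assms(2,3)] by eventually_elim (rule assms(4))
qed

text \<open>For a quadratic form the gradient is linear, hence globally Lipschitz and its own
  derivative.\<close>

lemma linear_gradient:
  assumes "linear g" and "\<And>x. GDERIV u x :> g x"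
  shows "C11_loc u" and "has_laplacian u (\<Sum>b\<in>Basis. g b \<bullet> b) x"
proof -
  have "bounded_linear g" using assms(1) by (simp add: linear_conv_bounded_linear)
  then obtain L where "L-lipschitz_on UNIV g" using bounded_linear.lipschitz_boundE by blast
  then show "C11_loc u"
    unfolding C11_loc_def using assms(2) lipschitz_on_subset[OF _ subset_UNIV, of L g] by (intro exI[of _ g]) auto
  have "(g has_derivative g) (at x)"
    using assms(1) by (simp add: linear_imp_has_derivative)
  then show "has_laplacian u (\<Sum>b\<in>Basis. g b \<bullet> b) x"
    using assms(2) by (intro has_laplacianI[where g = g and H = g]) simp_all
qed

definition diag_form :: "real \<Rightarrow> real \<Rightarrow> real^2 \<Rightarrow> real" where
  "diag_form a c x = a * (x $ 1)\<^sup>2 + c * (x $ 2)\<^sup>2"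

lemma GDERIV_diag_form: "GDERIV (diag_form a c) x :> vector [2 * a * x $ 1, 2 * c * x $ 2]"
  unfolding gderiv_def diag_form_def
  by (auto intro!: derivative_eq_intros bounded_linear.has_derivative[OF bounded_linear_vec_nth]
      simp: inner_real2 fun_eq_iff algebra_simps)

lemma C11_loc_diag_form: "C11_loc (diag_form a c)"
  and has_laplacian_diag_form: "has_laplacian (diag_form a c) (2 * (a + c)) x"
proof -
  have lin: "linear (\<lambda>x::real^2. vector [2 * a * x $ 1, 2 * c * x $ 2] :: real^2)"
    by (intro linearI vector2_eqI) (auto simp: algebra_simps)
  show "C11_loc (diag_form a c)"
    using linear_gradient(1)[OF lin GDERIV_diag_form] .
  show "has_laplacian (diag_form a c) (2 * (a + c)) x"
    using linear_gradient(2)[OF lin GDERIV_diag_form, of x]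
    by (simp add: sum_Basis_real2 inner_real2 axis_def algebra_simps)
qed

text \<open>The building block for a free boundary along a hyperplane: it is \<open>C11_loc\<close>,
  while its Laplacian jumps from 0 to \<open>2 * (n \<bullet> n)\<close> across the
  hyperplane.\<close>

definition pos_square :: "'a::euclidean_space \<Rightarrow> 'a \<Rightarrow> real" where
  "pos_square n x = (max 0 (x \<bullet> n))\<^sup>2"

lemma GDERIV_pos_square: "GDERIV (pos_square n) x :> (2 * max 0 (x \<bullet> n)) *\<^sub>R n"
proof -
  have max_sq: "((\<lambda>t. (max 0 t)\<^sup>2) has_real_derivative 2 * max 0 t) (at t)" for t :: real
  proof (cases "t = 0")
    case True
    have "((\<lambda>h. (max 0 h)\<^sup>2 / h) \<longlongrightarrow> 0) (at (0::real))"
    proof (rule Lim_null_comparison)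
      show "\<forall>\<^sub>F h in at (0::real). norm ((max 0 h)\<^sup>2 / h) \<le> \<bar>h\<bar>"
        by (rule always_eventually) (auto simp: power2_eq_square max_def)
      show "((\<lambda>h. \<bar>h\<bar>) \<longlongrightarrow> 0) (at (0::real))" by (auto intro!: tendsto_eq_intros)
    qed
    then show ?thesis by (simp add: DERIV_def True)
  next
    case False
    show ?thesis
    proof (cases "t > 0")
      case True
      have "((\<lambda>t. t\<^sup>2) has_real_derivative 2 * max 0 t) (at t)"
        using True by (auto intro!: derivative_eq_intros)
      then show ?thesis
        by (rule has_field_derivative_transform_within_open[where S = "{0<..}"]) (use True in auto)
    next
      case False
      have "((\<lambda>t. 0) has_real_derivative 2 * max 0 t) (at t)"
        using False by (auto intro!: derivative_eq_intros)
      then show ?thesis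
        by (rule has_field_derivative_transform_within_open[where S = "{..<0}"]) (use False \<open>t \<noteq> 0\<close> in auto)
    qed
  qed
  have "((\<lambda>x. x \<bullet> n) has_derivative (\<lambda>h. h \<bullet> n)) (at x)"
    by (auto intro!: derivative_eq_intros)
  from has_derivative_compose[OF this max_sq[unfolded has_field_derivative_def]]
  show ?thesis
    unfolding gderiv_def pos_square_def by (simp add: algebra_simps)
qed

lemma C11_loc_pos_square: "C11_loc (pos_square n)"
proof -
  have "(2 * (norm n)\<^sup>2)-lipschitz_on UNIV (\<lambda>x. (2 * max 0 (x \<bullet> n)) *\<^sub>R n)"
  proof (rule lipschitz_onI)
    fix x y
    have "\<bar>max 0 (x \<bullet> n) - max 0 (y \<bullet> n)\<bar> \<le> \<bar>(x - y) \<bullet> n\<bar>"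
      by (auto simp: inner_diff_left max_def)
    also have "\<dots> \<le> norm (x - y) * norm n" by (rule Cauchy_Schwarz_ineq2)
    finally have "2 * \<bar>max 0 (x \<bullet> n) - max 0 (y \<bullet> n)\<bar> * norm n \<le> 2 * (norm (x - y) * norm n) * norm n"
      by (intro mult_right_mono) auto
    moreover have "dist ((2 * max 0 (x \<bullet> n)) *\<^sub>R n) ((2 * max 0 (y \<bullet> n)) *\<^sub>R n) = 2 * \<bar>max 0 (x \<bullet> n) - max 0 (y \<bullet> n)\<bar> * norm n"
      unfolding dist_norm scaleR_left_diff_distrib[symmetric] right_diff_distrib[symmetric] norm_scaleR abs_mult
      by simp
    ultimately show "dist ((2 * max 0 (x \<bullet> n)) *\<^sub>R n) ((2 * max 0 (y \<bullet> n)) *\<^sub>R n) \<le> 2 * (norm n)\<^sup>2 * dist x y"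
      by (simp add: dist_norm power2_eq_square mult_ac)
  qed simp
  then show ?thesis
    unfolding C11_loc_def using GDERIV_pos_square lipschitz_on_subset[OF _ subset_UNIV]
    by (intro exI[of _ "\<lambda>x. (2 * max 0 (x \<bullet> n)) *\<^sub>R n"]) blast
qed

lemma has_laplacian_pos_square_pos:
  assumes "x \<bullet> n > 0"
  shows "has_laplacian (pos_square n) (2 * (n \<bullet> n)) x"
proof -
  have lin: "linear (\<lambda>x. (2 * (x \<bullet> n)) *\<^sub>R n)"
    by (intro linearI) (auto simp: algebra_simps)
  have der: "GDERIV (\<lambda>x. (x \<bullet> n)\<^sup>2) x :> (2 * (x \<bullet> n)) *\<^sub>R n" for x
    unfolding gderiv_def by (auto intro!: derivative_eq_intros simp: fun_eq_iff)
  have "has_laplacian (\<lambda>x. (x \<bullet> n)\<^sup>2) (\<Sum>b\<in>Basis. ((2 * (b \<bullet> n)) *\<^sub>R n) \<bullet> b) x"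
    using lin der by (rule linear_gradient)
  also have "(\<Sum>b\<in>Basis. ((2 * (b \<bullet> n)) *\<^sub>R n) \<bullet> b) = 2 * (n \<bullet> n)"
    by (simp add: euclidean_inner[of n n] sum_distrib_left inner_commute mult_ac)
  finally show ?thesis
    by (rule has_laplacian_open_transform[where A = "{x. x \<bullet> n > 0}"])
      (use assms open_halfspace_gt[of 0 n] in \<open>auto simp: pos_square_def inner_commute\<close>)
qed

lemma has_laplacian_pos_square_neg:
  assumes "x \<bullet> n < 0"
  shows "has_laplacian (pos_square n) 0 x"
proof -
  have "has_laplacian (\<lambda>x. 0) 0 x"
    by (rule has_laplacianI[where g = "\<lambda>_. 0" and H = "\<lambda>_. 0"]) (simp_all add: GDERIV_const)
  then show ?thesis
    by (rule has_laplacian_open_transform[where A = "{x. x \<bullet> n < 0}"])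
      (use assms open_halfspace_lt[of n 0] in \<open>auto simp: pos_square_def inner_commute\<close>)
qed

section \<open>Invariance under orthogonal involutions\<close>

lemma C11_loc_compose_involution:
  fixes R :: "'a::euclidean_space \<Rightarrow> 'a"
  assumes R: "orthogonal_transformation R" "\<And>x. R (R x) = x" and "C11_loc u"
  shows "C11_loc (u \<circ> R)"
proof -
  obtain g where g: "\<And>x. GDERIV u x :> g x" "\<And>K. compact K \<Longrightarrow> \<exists>L. L-lipschitz_on K g"
    using assms(3) unfolding C11_loc_def by metis
  have lin: "linear R" using R(1) by (rule orthogonal_transformation_linear)
  have "GDERIV (u \<circ> R) x :> R (g (R x))" for x
  proof -
    have "R h \<bullet> g (R x) = h \<bullet> R (g (R x))" for h
      using R by (metis orthogonal_transformation_def)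
    then show ?thesis
      using has_derivative_compose[OF linear_imp_has_derivative[OF lin, of "at x"] g(1)[of "R x", unfolded gderiv_def]]
      by (simp add: gderiv_def o_def)
  qed
  moreover have "\<exists>L. L-lipschitz_on K (\<lambda>x. R (g (R x)))" if "compact K" for K
  proof -
    have "compact (R ` K)" 
      using lin that by (intro compact_continuous_image linear_continuous_on) (simp_all add: linear_conv_bounded_linear)
    then obtain L where "L-lipschitz_on (R ` K) g" using g(2) by blast
    then have "L-lipschitz_on K (\<lambda>x. R (g (R x)))"
      using R(1) unfolding lipschitz_on_def by (simp add: orthogonal_transformation_isometry)
    then show ?thesis by blast
  qed
  ultimately show ?thesis
    unfolding C11_loc_def by (intro exI[of _ "\<lambda>x. R (g (R x))"]) simp
qed

text \<open>An orthogonal involution is self-adjoint, so the gradient of \<open>u \<circ> R\<close>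
  is \<open>R (g (R y))\<close> and its derivative is that of \<open>g\<close> conjugated by
  \<open>R\<close>. Conjugation preserves the trace, as expanding \<open>R b\<close> in the basis
  and exchanging the sums shows.\<close>

lemma has_laplacian_compose_involution:
  fixes R :: "'a::euclidean_space \<Rightarrow> 'a"
  assumes R: "orthogonal_transformation R" "\<And>x. R (R x) = x" and "has_laplacian u l (R x)"
  shows "has_laplacian (u \<circ> R) l x"
proof -
  obtain g H where g: "\<forall>\<^sub>F y in nhds (R x). GDERIV u y :> g y" "(g has_derivative H) (at (R x))" "l = (\<Sum>b\<in>Basis. H b \<bullet> b)"
    using assms(3) unfolding has_laplacian_def by blast
  have lin: "linear R" using R(1) by (rule orthogonal_transformation_linear)
  have adj: "R v \<bullet> w = v \<bullet> R w" for v w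
    using R by (metis orthogonal_transformation_def)
  have "filterlim R (nhds (R x)) (nhds x)"
    using lin by (metis linear_continuous_at linear_conv_bounded_linear isCont_def tendsto_at_iff_tendsto_nhds)
  from filterlim_iff[THEN iffD1, OF this] g(1)
  have "\<forall>\<^sub>F y in nhds x. GDERIV u (R y) :> g (R y)" by blast
  then have "\<forall>\<^sub>F y in nhds x. GDERIV (u \<circ> R) y :> R (g (R y))"
  proof eventually_elim
    case (elim y)
    then show ?case
      using has_derivative_compose[OF linear_imp_has_derivative[OF lin] elim[unfolded gderiv_def]]
      by (simp add: gderiv_def o_def adj)
  qed
  moreover have "((\<lambda>y. R (g (R y))) has_derivative (\<lambda>h. R (H (R h)))) (at x)"
    by (intro has_derivative_compose[OF _ linear_imp_has_derivative[OF lin]]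
        has_derivative_compose[OF linear_imp_has_derivative[OF lin] g(2)])
  moreover have "l = (\<Sum>b\<in>Basis. R (H (R b)) \<bullet> b)"
  proof -
    have "linear H" using g(2) has_derivative_linear by blast
    have "H (R b) \<bullet> R b = (\<Sum>c\<in>Basis. (R b \<bullet> c) * (H c \<bullet> R b))" for b
    proof -
      have "H (R b) = H (\<Sum>c\<in>Basis. (R b \<bullet> c) *\<^sub>R c)" by (simp add: euclidean_representation)
      also have "\<dots> = (\<Sum>c\<in>Basis. (R b \<bullet> c) *\<^sub>R H c)"
        using \<open>linear H\<close> by (simp add: linear_sum linear_scale)
      finally show ?thesis by (simp add: inner_sum_left)
    qed
    then have "(\<Sum>b\<in>Basis. R (H (R b)) \<bullet> b) = (\<Sum>b\<in>Basis. \<Sum>c\<in>Basis. (R b \<bullet> c) * (H c \<bullet> R b))"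
      by (simp add: adj)
    also have "\<dots> = (\<Sum>c\<in>Basis. \<Sum>b\<in>Basis. (R c \<bullet> b) * (R (H c) \<bullet> b))"
    proof (subst sum.swap, intro sum.cong refl)
      fix b c
      show "(R b \<bullet> c) * (H c \<bullet> R b) = (R c \<bullet> b) * (R (H c) \<bullet> b)"
        using adj[of b c] adj[of "H c" b] by (simp add: inner_commute)
    qed
    also have "\<dots> = (\<Sum>c\<in>Basis. R c \<bullet> R (H c))"
      by (simp only: euclidean_inner[symmetric])
    also have "\<dots> = l" using R by (simp add: g(3) adj inner_commute)
    finally show ?thesis by simp
  qed
  ultimately show ?thesis by (rule has_laplacianI)
qed

lemma double_obstacle_solution_compose_involution:
  assumes R: "orthogonal_transformation R" "\<And>x. R (R x) = x" and u: "double_obstacle_solution p1 p2 u"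
  shows "double_obstacle_solution (p1 \<circ> R) (p2 \<circ> R) (u \<circ> R)"
proof -
  \<comment> \<open>Equivalence of the predicates makes the definite descriptions equal, even at
    points without a Laplacian.\<close>
  have lap: "laplacian (p \<circ> R) x = laplacian p (R x)" for p x
  proof -
    have "has_laplacian (p \<circ> R) l x \<longleftrightarrow> has_laplacian p l (R x)" for l
      using has_laplacian_compose_involution[OF R, of "p \<circ> R" l "R x"]
        has_laplacian_compose_involution[OF R, of p l x] R(2) by (auto simp: o_def)
    then show ?thesis by (simp add: laplacian_def)
  qed
  let ?Q = "\<lambda>x. has_laplacian u (laplacian p1 x * indicator {y. u y = p1 y} x +
         laplacian p2 x * indicator {y. u y = p2 y} x) x"
  have "AE x in lebesgue. ?Q x" using u by (simp add: double_obstacle_solution_def)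
  then have "negligible (R ` {x. \<not> ?Q x})"
    by (intro negligible_differentiable_image_negligible lebesgue_AE_negligible linear_imp_differentiable_on
        orthogonal_transformation_linear R) simp_all
  moreover have "{x. \<not> ?Q (R x)} \<subseteq> R ` {x. \<not> ?Q x}"
    using R(2) by (metis (mono_tags, lifting) image_eqI mem_Collect_eq subsetI)
  ultimately have "negligible {x. \<not> ?Q (R x)}" by (rule negligible_subset)
  then have "AE x in lebesgue. ?Q (R x)"
    by (rule negligible_AE_lebesgue)
  then have "AE x in lebesgue. has_laplacian (u \<circ> R) (laplacian (p1 \<circ> R) x * indicator {y. (u \<circ> R) y = (p1 \<circ> R) y} x +
         laplacian (p2 \<circ> R) x * indicator {y. (u \<circ> R) y = (p2 \<circ> R) y} x) x"
    by (rule eventually_mono) (auto simp: lap indicator_def intro: has_laplacian_compose_involution[OF R])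
  then show ?thesis
    using u C11_loc_compose_involution[OF R] by (auto simp: double_obstacle_solution_def)
qed

section \<open>Sectors and reflections\<close>

text \<open>\<open>normal t\<close> is \<open>dir t\<close> turned counterclockwise by a quarter
  circle, so the inner product with \<open>normal t\<close> is positive for directions just beyond
  angle \<open>t\<close>.\<close>

definition dir :: "real \<Rightarrow> real^2" where "dir t = vector [cos t, sin t]"
definition normal :: "real \<Rightarrow> real^2" where "normal t = vector [- sin t, cos t]"
definition sector :: "real \<Rightarrow> real \<Rightarrow> (real^2) set" where
  "sector a b = {r *\<^sub>R dir t | r t. r \<ge> 0 \<and> t \<in> {a..b}}"

lemma dir_nth [simp]: "dir t $ 1 = cos t" "dir t $ 2 = sin t"
  and normal_nth [simp]: "normal t $ 1 = - sin t" "normal t $ 2 = cos t"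
  by (simp_all add: dir_def normal_def)

lemma halfcone_iff_sector: "halfcone K \<longleftrightarrow> (\<exists>a b. 0 < b - a \<and> b - a < pi \<and> K = sector a b)"
proof -
  have "vector [r * cos t, r * sin t] = r *\<^sub>R dir t" for r t
    by (intro vector2_eqI) auto
  then show ?thesis by (simp add: halfcone_def sector_def)
qed

lemma dir_inner_normal: "dir t \<bullet> normal s = sin (t - s)"
  by (simp add: inner_real2 sin_diff)

lemma normal_inner_self [simp]: "normal s \<bullet> normal s = 1"
  using sin_cos_squared_add[of s] by (simp add: inner_real2 power2_eq_square)

lemma norm_dir [simp]: "norm (dir t) = 1"
  by (simp add: norm_eq_sqrt_inner inner_real2 flip: power2_eq_square)

lemma dir_eq_iff: "dir s = dir t \<longleftrightarrow> (\<exists>k::int. s = t + 2 * pi * k)"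
  using sin_cos_eq_iff[of s t] by (auto simp: vec_eq_iff forall_2)

lemma dir_plus_2pi [simp]: "dir (t + 2 * pi * of_int k) = dir t"
  by (auto simp: dir_eq_iff)

lemma scaleR_dir_eq_iff:
  assumes "r > 0" "r' \<ge> 0"
  shows "r *\<^sub>R dir s = r' *\<^sub>R dir t \<longleftrightarrow> r = r' \<and> dir s = dir t"
proof
  assume eq: "r *\<^sub>R dir s = r' *\<^sub>R dir t"
  then have "norm (r *\<^sub>R dir s) = norm (r' *\<^sub>R dir t)" by simp
  then have "r = r'" using assms by simp
  with eq assms show "r = r' \<and> dir s = dir t" by simp
qed simp

lemma scaleR_dir_in_sector:
  assumes "r > 0"
  shows "r *\<^sub>R dir t \<in> sector a b \<longleftrightarrow> (\<exists>k::int. t + 2 * pi * k \<in> {a..b})"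
proof
  assume "r *\<^sub>R dir t \<in> sector a b"
  then obtain r' s where s: "r *\<^sub>R dir t = r' *\<^sub>R dir s" "r' \<ge> 0" "s \<in> {a..b}"
    unfolding sector_def by blast
  then have "dir s = dir t" using assms by (simp add: scaleR_dir_eq_iff)
  then show "\<exists>k::int. t + 2 * pi * k \<in> {a..b}" using s(3) by (auto simp: dir_eq_iff)
next
  assume "\<exists>k::int. t + 2 * pi * k \<in> {a..b}"
  then obtain k :: int where "t + 2 * pi * k \<in> {a..b}" by blast
  moreover have "r *\<^sub>R dir t = r *\<^sub>R dir (t + 2 * pi * k)" by simp
  ultimately show "r *\<^sub>R dir t \<in> sector a b"
    unfolding sector_def using assms by (metis (mono_tags, lifting) mem_Collect_eq less_imp_le)
qed

lemma in_sectorI: "r \<ge> 0 \<Longrightarrow> t \<in> {a..b} \<Longrightarrow> r *\<^sub>R dir t \<in> sector a b"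
  unfolding sector_def by blast

lemma notin_sector:
  assumes "r > 0" "b < t" "t < a + 2 * pi"
  shows "r *\<^sub>R dir t \<notin> sector a b"
proof
  assume "r *\<^sub>R dir t \<in> sector a b"
  then obtain k :: int where k: "a \<le> t + 2 * pi * k" "t + 2 * pi * k \<le> b"
    using assms(1) by (auto simp: scaleR_dir_in_sector)
  then have "2 * pi * k < 2 * pi * 0" "2 * pi * (-1) < 2 * pi * k" using assms by auto
  then have "k < 0" "-1 < k"
    using mult_less_cancel_left_pos[of "2 * pi" "of_int k" 0] mult_less_cancel_left_pos[of "2 * pi" "-1" "of_int k"]
    by auto
  then show False by simp
qed

lemma sector_shift: "sector (a + 2 * pi * of_int k) (b + 2 * pi * of_int k) = sector a b"
proof -
  have sub: "sector a b \<subseteq> sector (a + 2 * pi * of_int k) (b + 2 * pi * of_int k)" for a b and k :: int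
  proof
    fix x assume "x \<in> sector a b"
    then obtain r t where "x = r *\<^sub>R dir t" "r \<ge> 0" "t \<in> {a..b}" unfolding sector_def by blast
    then show "x \<in> sector (a + 2 * pi * of_int k) (b + 2 * pi * of_int k)"
      using in_sectorI[of r "t + 2 * pi * of_int k"] by simp
  qed
  show ?thesis
    using sub[of "a + 2 * pi * of_int k" "b + 2 * pi * of_int k" "- k"] sub[of a b k] by simp
qed

lemma shift_into_period: "\<exists>k::int. s < t + 2 * pi * k \<and> t + 2 * pi * k \<le> s + 2 * pi"
proof -
  define k where "k = \<lfloor>(s - t) / (2 * pi)\<rfloor> + 1"
  have "of_int k - 1 \<le> (s - t) / (2 * pi)" "(s - t) / (2 * pi) < of_int k"
    unfolding k_def by linarith+
  then show ?thesis by (intro exI[of _ k]) (simp add: field_simps)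
qed

text \<open>The branch cut \<open>s\<close> is left open, so that each use can take the period that
  suits its sectors.\<close>

lemma polar_form:
  obtains r t where "r \<ge> 0" "s < t" "t \<le> s + 2 * pi" "x = r *\<^sub>R dir t"
proof -
  have "\<exists>t. x = norm x *\<^sub>R dir t"
  proof (cases "x = 0")
    case False
    have "(norm x)\<^sup>2 = (x $ 1)\<^sup>2 + (x $ 2)\<^sup>2"
      by (simp only: power2_norm_eq_inner inner_real2) (simp only: power2_eq_square)
    moreover have "(norm x)\<^sup>2 \<noteq> 0" using False by simp
    ultimately have "(x $ 1 / norm x)\<^sup>2 + (x $ 2 / norm x)\<^sup>2 = 1"
      by (simp add: power_divide flip: add_divide_distrib)
    then obtain t where "x $ 1 / norm x = cos t" "x $ 2 / norm x = sin t"
      using sincos_total_2pi by metis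
    then have "x = norm x *\<^sub>R dir t"
      using False by (intro vector2_eqI) (auto simp: field_simps)
    then show ?thesis by blast
  qed auto
  then obtain t where t: "x = norm x *\<^sub>R dir t" by blast
  obtain k :: int where "s < t + 2 * pi * k" "t + 2 * pi * k \<le> s + 2 * pi"
    using shift_into_period by blast
  then show thesis
    using that[of "norm x" "t + 2 * pi * k"] t by simp
qed

text \<open>An intersection of half planes is open and convex, as \<open>unique_continuation\<close>
  asks. For \<open>s < t < s + pi\<close> it consists of the directions with angle strictly between
  \<open>s\<close> and \<open>t\<close>.\<close>

definition wedge :: "real \<Rightarrow> real \<Rightarrow> (real^2) set" where
  "wedge s t = {x. x \<bullet> normal s > 0} \<inter> {x. x \<bullet> normal t < 0}"

lemma open_wedge: "open (wedge s t)" and convex_wedge: "convex (wedge s t)"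
  unfolding wedge_def inner_commute[of _ "normal _"]
  by (intro open_Int open_halfspace_gt open_halfspace_lt convex_Int convex_halfspace_gt convex_halfspace_lt)+

lemma wedgeE:
  assumes "x \<in> wedge s t" "s < t" "t < s + pi"
  obtains r \<theta> where "r > 0" "s < \<theta>" "\<theta> < t" "x = r *\<^sub>R dir \<theta>"
proof -
  obtain r \<theta> where r: "r \<ge> 0" "s < \<theta>" "\<theta> \<le> s + 2 * pi" "x = r *\<^sub>R dir \<theta>"
    by (rule polar_form)
  have pos: "r * sin (\<theta> - s) > 0" "r * sin (\<theta> - t) < 0"
    using assms(1) by (simp_all add: wedge_def r dir_inner_normal)
  then have "r > 0" using r(1) by (cases "r = 0") auto
  then have sin: "sin (\<theta> - s) > 0" "sin (\<theta> - t) < 0"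
    using pos by (simp_all add: zero_less_mult_iff mult_less_0_iff)
  have "\<theta> < s + pi"
  proof (rule ccontr)
    assume "\<not> \<theta> < s + pi"
    then have "sin (\<theta> - s - pi) \<ge> 0" using r by (intro sin_ge_zero) auto
    then show False using sin(1) by (simp add: sin_diff)
  qed
  moreover have "\<theta> < t"
  proof (rule ccontr)
    assume "\<not> \<theta> < t"
    then have "sin (\<theta> - t) \<ge> 0" using \<open>\<theta> < s + pi\<close> assms by (intro sin_ge_zero) auto
    then show False using sin(2) by simp
  qed
  ultimately show thesis using that \<open>r > 0\<close> r by blast
qed

lemma in_wedgeI:
  assumes "r > 0" "s < \<theta>" "\<theta> < t" "t < s + pi"
  shows "r *\<^sub>R dir \<theta> \<in> wedge s t"
proof -
  have "sin (\<theta> - s) > 0" "sin (t - \<theta>) > 0" using assms by (auto intro!: sin_gt_zero)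
  moreover have "sin (\<theta> - t) = - sin (t - \<theta>)" by (simp add: sin_diff)
  ultimately show ?thesis
    using assms(1) by (simp add: wedge_def dir_inner_normal mult_pos_neg)
qed

text \<open>The reflection in the line of angle \<open>\<phi> / 2\<close>: it takes polar angle
  \<open>t\<close> to \<open>\<phi> - t\<close>.\<close>

definition reflection :: "real \<Rightarrow> real^2 \<Rightarrow> real^2" where
  "reflection \<phi> x = vector [cos \<phi> * x $ 1 + sin \<phi> * x $ 2, sin \<phi> * x $ 1 - cos \<phi> * x $ 2]"

lemma reflection_nth [simp]:
  "reflection \<phi> x $ 1 = cos \<phi> * x $ 1 + sin \<phi> * x $ 2"
  "reflection \<phi> x $ 2 = sin \<phi> * x $ 1 - cos \<phi> * x $ 2"
  by (simp_all add: reflection_def)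

lemma reflection_reflection [simp]: "reflection \<phi> (reflection \<phi> x) = x"
proof -
  have "cos \<phi> * (cos \<phi> * z) + sin \<phi> * (sin \<phi> * z) = ((sin \<phi>)\<^sup>2 + (cos \<phi>)\<^sup>2) * z" for z
    by (simp only: power2_eq_square distrib_right mult.assoc add.commute)
  then have eq: "cos \<phi> * (cos \<phi> * z) + sin \<phi> * (sin \<phi> * z) = z" for z
    by simp
  show ?thesis by (intro vector2_eqI; simp add: algebra_simps; rule eq)
qed

lemma orthogonal_reflection: "orthogonal_transformation (reflection \<phi>)"
proof -
  have lin: "linear (reflection \<phi>)"
    by (intro linearI vector2_eqI) (auto simp: algebra_simps)
  have self_adjoint: "reflection \<phi> v \<bullet> w = v \<bullet> reflection \<phi> w" for v w
    by (simp add: inner_real2 algebra_simps)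
  show ?thesis
    unfolding orthogonal_transformation_def using lin by (simp add: self_adjoint)
qed

lemma reflection_dir: "reflection \<phi> (r *\<^sub>R dir t) = r *\<^sub>R dir (\<phi> - t)"
  by (intro vector2_eqI) (auto simp: sin_diff cos_diff algebra_simps)

lemma reflection_sector: "{x. reflection \<phi> x \<in> sector a b} = sector (\<phi> - b) (\<phi> - a)"
proof -
  have sub: "reflection \<phi> x \<in> sector (\<phi> - b) (\<phi> - a)" if x: "x \<in> sector a b" for x a b
  proof -
    obtain r t where "x = r *\<^sub>R dir t" "r \<ge> 0" "t \<in> {a..b}" using x unfolding sector_def by blast
    then show ?thesis using in_sectorI[of r "\<phi> - t"] by (simp add: reflection_dir)
  qed
  show ?thesis
    using sub[of _ a b] sub[of _ "\<phi> - b" "\<phi> - a"] by fastforce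
qed

section \<open>Matching conditions at the edges\<close>

lemma diag_form_dir: "diag_form a c (r *\<^sub>R dir t) = r\<^sup>2 * ((a + c) + (a - c) * cos (2 * t)) / 2"
proof -
  have sq: "(sin t)\<^sup>2 = (1 - cos (2 * t)) / 2" "(cos t)\<^sup>2 = (1 + cos (2 * t)) / 2"
    by (simp_all add: cos_squared_eq cos_double_sin)
  have "diag_form a c (r *\<^sub>R dir t) = a * (r\<^sup>2 * (cos t)\<^sup>2) + c * (r\<^sup>2 * (sin t)\<^sup>2)"
    by (simp add: diag_form_def power_mult_distrib)
  then show ?thesis unfolding sq by (simp add: field_simps)
qed

lemma diag_form_less:
  assumes "a1 < a2" "c1 < c2" "x \<noteq> 0"
  shows "diag_form a1 c1 x < diag_form a2 c2 x"
proof -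
  have "x $ 1 \<noteq> 0 \<or> x $ 2 \<noteq> 0" using assms(3) by (auto simp: vec_eq_iff forall_2)
  then have "0 < (a2 - a1) * (x $ 1)\<^sup>2 + (c2 - c1) * (x $ 2)\<^sup>2"
    using assms by (auto intro: add_pos_nonneg add_nonneg_pos)
  then show ?thesis by (simp add: diag_form_def algebra_simps)
qed

text \<open>The harmonic quadratic form with the Cauchy data of \<open>diag_form a c\<close> on the line of angle \<open>t\<close>.\<close>

definition harmonic_match :: "real \<Rightarrow> real \<Rightarrow> real \<Rightarrow> real^2 \<Rightarrow> real" where
  "harmonic_match a c t x = diag_form a c x - (a + c) * (x \<bullet> normal t)\<^sup>2"

text \<open>In complex notation the form is half the real part of conj(w) z^2 with w = (a - c) + (a
  + c) cis (2 b). Two matched forms coincide if their points w, each on its own circle,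
  coincide.\<close>

lemma harmonic_match_dir:
  "harmonic_match a c b (r *\<^sub>R dir t) =
    r\<^sup>2 * (((a - c) + (a + c) * cos (2 * b)) * cos (2 * t) + (a + c) * sin (2 * b) * sin (2 * t)) / 2"
proof -
  have "(sin (t - b))\<^sup>2 = (1 - cos (2 * t - 2 * b)) / 2"
    using cos_double_sin[of "t - b"] by (simp add: right_diff_distrib)
  then have sq: "(sin (t - b))\<^sup>2 = (1 - (cos (2 * t) * cos (2 * b) + sin (2 * t) * sin (2 * b))) / 2"
    by (simp only: cos_diff)
  have "harmonic_match a c b (r *\<^sub>R dir t) = r\<^sup>2 * ((a + c) + (a - c) * cos (2 * t)) / 2 - (a + c) * (r\<^sup>2 * (sin (t - b))\<^sup>2)"
    by (simp only: harmonic_match_def diag_form_dir inner_scaleR_left dir_inner_normal power_mult_distrib)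
  then show ?thesis unfolding sq by (simp add: field_simps)
qed

text \<open>The edges are listed counterclockwise within one turn, so the noncontact sectors run
  from \<open>b\<close> to \<open>c\<close> and from \<open>d\<close> to
  \<open>a + 2 * pi\<close>.\<close>

definition cone_configuration :: "real \<Rightarrow> real \<Rightarrow> real \<Rightarrow> real \<Rightarrow> (real^2 \<Rightarrow> real) \<Rightarrow> real \<Rightarrow> real \<Rightarrow> real \<Rightarrow> real \<Rightarrow> bool" where
  "cone_configuration a1 c1 a2 c2 u a b c d \<longleftrightarrow>
    double_obstacle_solution (diag_form a1 c1) (diag_form a2 c2) u \<and>
    {x. u x = diag_form a1 c1 x} = sector a b \<and> {x. u x = diag_form a2 c2 x} = sector c d \<and>
    a < b \<and> b < c \<and> c < d \<and> d < a + 2 * pi \<and> b < a + pi \<and> d < c + pi"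

text \<open>Since the obstacles differ away from the origin, the contact sectors share no direction.
  Once \<open>c\<close> is shifted into the turn after \<open>b\<close>, neither \<open>c\<close>
  nor \<open>d\<close> can reach \<open>a + 2 * pi\<close> without producing a common
  direction.\<close>

lemma cone_configuration_exists:
  assumes "a1 < a2" "c1 < c2" and sol: "double_cone_solution (diag_form a1 c1) (diag_form a2 c2) u"
    and ab: "a < b" "b < a + pi" and S1: "{x. u x = diag_form a1 c1 x} = sector a b"
  obtains c d where "cone_configuration a1 c1 a2 c2 u a b c d"
proof -
  obtain c0 d0 where cd0: "0 < d0 - c0" "d0 - c0 < pi" "{x. u x = diag_form a2 c2 x} = sector c0 d0"
    using sol by (auto simp: double_cone_solution_def halfcone_iff_sector)
  obtain k :: int where k: "b < c0 + 2 * pi * k" "c0 + 2 * pi * k \<le> b + 2 * pi"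
    using shift_into_period by blast
  define c d where "c = c0 + 2 * pi * k" and "d = d0 + 2 * pi * k"
  have S2: "{x. u x = diag_form a2 c2 x} = sector c d"
    unfolding c_def d_def by (simp add: sector_shift cd0(3))
  have disj: False if "dir t \<in> sector a b" "dir t \<in> sector c d" for t
  proof -
    have "u (dir t) = diag_form a1 c1 (dir t)" "u (dir t) = diag_form a2 c2 (dir t)"
      using that unfolding S1[symmetric] S2[symmetric] by simp_all
    moreover have "dir t \<noteq> 0" using norm_dir[of t] by (metis norm_zero zero_neq_one)
    ultimately show False using diag_form_less[OF assms(1,2)] by fastforce
  qed
  have shift: "dir t \<in> sector a b" if "t - 2 * pi \<in> {a..b}" for t
  proof -
    have "dir t = dir (t - 2 * pi)" using dir_plus_2pi[of t "-1"] by simp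
    then show ?thesis using in_sectorI[of 1 "t - 2 * pi"] that by simp
  qed
  have "c < d" using cd0 by (simp add: c_def d_def)
  have "c < a + 2 * pi"
    using disj[of c] shift[of c] in_sectorI[of 1 c c d] k \<open>c < d\<close> by (fastforce simp: c_def)
  have "d < a + 2 * pi"
  proof (rule ccontr)
    assume "\<not> d < a + 2 * pi"
    then show False
      using disj[of "a + 2 * pi"] shift[of "a + 2 * pi"] in_sectorI[of 1 "a + 2 * pi" c d] \<open>c < a + 2 * pi\<close> ab by auto
  qed
  have "cone_configuration a1 c1 a2 c2 u a b c d"
    using sol S1 S2 ab \<open>c < d\<close> \<open>d < a + 2 * pi\<close> k cd0
    by (auto simp: cone_configuration_def double_cone_solution_def c_def d_def)
  then show thesis by (rule that)
qed

lemma diag_form_reflection_0: "diag_form a c \<circ> reflection 0 = diag_form a c"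
  by (auto simp: diag_form_def fun_eq_iff)

text \<open>The reflection in the first axis preserves the obstacles and exchanges the two
  noncontact sectors, so facts about the edges \<open>b\<close> and \<open>c\<close> carry over to
  \<open>a\<close> and \<open>d\<close>.\<close>

lemma cone_configuration_reflect:
  assumes "cone_configuration a1 c1 a2 c2 u a b c d"
  shows "cone_configuration a1 c1 a2 c2 (u \<circ> reflection 0) (- b) (- a) (2 * pi - d) (2 * pi - c)"
proof -
  have "double_obstacle_solution (diag_form a1 c1) (diag_form a2 c2) (u \<circ> reflection 0)"
    using double_obstacle_solution_compose_involution[OF orthogonal_reflection reflection_reflection, of "diag_form a1 c1" "diag_form a2 c2" u 0] assms
    by (simp add: diag_form_reflection_0 cone_configuration_def)
  moreover have "{x. (u \<circ> reflection 0) x = diag_form p q x} = sector (- t) (- s)"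
    if "{x. u x = diag_form p q x} = sector s t" for p q s t
  proof -
    have "{x. (u \<circ> reflection 0) x = diag_form p q x} = {x. reflection 0 x \<in> {x. u x = diag_form p q x}}"
      using diag_form_reflection_0[of p q] by (auto simp: fun_eq_iff)
    then show ?thesis unfolding that reflection_sector by simp
  qed
  moreover have "sector (- d) (- c) = sector (2 * pi - d) (2 * pi - c)"
    using sector_shift[of "- d" 1 "- c"] by (simp add: algebra_simps)
  ultimately show ?thesis
    using assms unfolding cone_configuration_def by auto
qed

text \<open>Unique continuation carries the matched form from the edge \<open>b\<close> up to
  \<open>c\<close>. There \<open>u\<close> touches \<open>p2\<close> from below, so value and
  angular derivative agree with those of \<open>p2\<close>; these two equations determine both
  coefficients of the form.\<close>

lemma
  assumes conf: "cone_configuration a1 c1 a2 c2 u a b c d"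
  shows cone_configuration_between: "\<And>r t. r \<ge> 0 \<Longrightarrow> t \<in> {b..c} \<Longrightarrow> u (r *\<^sub>R dir t) = harmonic_match a1 c1 b (r *\<^sub>R dir t)"
    and cone_configuration_cos: "(a1 - c1) + (a1 + c1) * cos (2 * b) = (a2 - c2) + (a2 + c2) * cos (2 * c)"
    and cone_configuration_sin: "(a1 + c1) * sin (2 * b) = (a2 + c2) * sin (2 * c)"
proof -
  let ?p1 = "diag_form a1 c1" and ?p2 = "diag_form a2 c2"
  have C11: "C11_loc u" and bounds: "\<And>x. u x \<le> ?p2 x"
    and lap: "AE x in lebesgue. has_laplacian u (laplacian ?p1 x * indicator {y. u y = ?p1 y} x +
         laplacian ?p2 x * indicator {y. u y = ?p2 y} x) x"
    and S1: "{x. u x = ?p1 x} = sector a b" and S2: "{x. u x = ?p2 x} = sector c d"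
    and ord: "a < b" "b < c" "c < d" "d < a + 2 * pi" "b < a + pi" "d < c + pi"
    using conf by (auto simp: cone_configuration_def double_obstacle_solution_def)
  have u1: "u x = ?p1 x \<longleftrightarrow> x \<in> sector a b" and u2: "u x = ?p2 x \<longleftrightarrow> x \<in> sector c d" for x
    using S1 S2 by auto
  obtain g where g: "\<And>x. GDERIV u x :> g x" using C11 unfolding C11_loc_def by blast
  \<comment> \<open>Subtracting the harmonic continuation of \<open>p1\<close> across the edge leaves a function harmonic near
    the edge that vanishes inside the contact sector.\<close>
  define V where "V x = u x + ((-1) * ?p1 x + (a1 + c1) * pos_square (normal b) x)" for x
  have "C11_loc V"
    unfolding V_def by (intro C11_loc_add C11 C11_loc_cmult C11_loc_diag_form C11_loc_pos_square)
  have open_part: "u (r *\<^sub>R dir \<theta>) = harmonic_match a1 c1 b (r *\<^sub>R dir \<theta>)"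
    if r: "r > 0" and \<theta>: "b < \<theta>" "\<theta> < c" "\<theta> < b + pi" for r \<theta>
  proof -
    \<comment> \<open>The wedge from \<open>s\<close> to \<open>t\<close> has opening below
      \<open>pi\<close>, contains the angle \<open>\<theta>\<close>, reaches back across the edge
      \<open>b\<close> into the contact sector, where \<open>V\<close> vanishes, and ends before the
      sector of \<open>p2\<close>.\<close>
    obtain t where t: "\<theta> < t" "t < c" "t < b + pi"
      using dense[of \<theta> "min c (b + pi)"] \<theta> by auto
    obtain s where s: "a < s" "t - pi < s" "s < b"
      using dense[of "max a (t - pi)" b] t ord by auto
    have V0: "V x = 0" if x_wedge: "x \<in> wedge s b" for x
    proof -
      obtain \<rho> \<alpha> where x: "\<rho> > 0" "s < \<alpha>" "\<alpha> < b" "x = \<rho> *\<^sub>R dir \<alpha>"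
        using wedgeE[OF x_wedge] s ord by auto
      have "u x = ?p1 x" unfolding u1 x(4) using x s by (intro in_sectorI) auto
      moreover have "x \<bullet> normal b < 0" using x_wedge by (simp add: wedge_def)
      ultimately show ?thesis by (simp add: V_def pos_square_def)
    qed
    have V_lap: "has_laplacian V 0 x"
      if x: "x \<in> wedge s t" "x \<bullet> normal b \<noteq> 0"
        and l: "has_laplacian u (laplacian ?p1 x * indicator {y. u y = ?p1 y} x +
          laplacian ?p2 x * indicator {y. u y = ?p2 y} x) x" for x
    proof -
      obtain \<rho> \<alpha> where \<alpha>: "\<rho> > 0" "s < \<alpha>" "\<alpha> < t" "x = \<rho> *\<^sub>R dir \<alpha>"
        using wedgeE[OF x(1)] s t \<theta> by auto
      show ?thesis
      proof (cases "\<alpha> < b")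
        case True
        then have "x \<in> wedge s b" using \<alpha> s ord by (auto intro: in_wedgeI)
        moreover have "has_laplacian (\<lambda>x::real^2. 0) 0 x"
          by (rule has_laplacianI[where g = "\<lambda>_. 0" and H = "\<lambda>_. 0"]) (simp_all add: GDERIV_const)
        ultimately show ?thesis
          using V0 by (auto intro: has_laplacian_open_transform[OF _ open_wedge])
      next
        case False
        have "\<alpha> \<noteq> b" using x(2) by (auto simp: \<alpha>(4) dir_inner_normal)
        with False have "b < \<alpha>" by simp
        then have "sin (\<alpha> - b) > 0" using \<alpha> t by (intro sin_gt_zero) auto
        then have pos: "x \<bullet> normal b > 0" using \<alpha> by (simp add: dir_inner_normal)
        \<comment> \<open>The sector of \<open>p2\<close> is also described one turn earlier, which
          puts \<open>\<alpha>\<close> into the gap between \<open>d - 2 * pi\<close> and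
          \<open>c\<close>.\<close>
        have "x \<notin> sector a b" "x \<notin> sector c d"
          using \<open>b < \<alpha>\<close> \<alpha> t ord notin_sector[of \<rho> b \<alpha> a] notin_sector[of \<rho> "d - 2 * pi" \<alpha> "c - 2 * pi"]
            sector_shift[of c "-1" d]
          by auto
        then have "has_laplacian u 0 x" using l by (simp add: u1 u2)
        then have "has_laplacian V (0 + ((-1) * (2 * (a1 + c1)) + (a1 + c1) * (2 * (normal b \<bullet> normal b)))) x"
          unfolding V_def
          by (intro has_laplacian_add has_laplacian_cmult has_laplacian_diag_form has_laplacian_pos_square_pos pos)
        then show ?thesis by simp
      qed
    qed
    have "normal b \<noteq> 0" using normal_inner_self[of b] by (metis inner_zero_left zero_neq_one)
    then have off_line: "AE x in lebesgue. x \<bullet> normal b \<noteq> 0"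
      by (rule AE_off_hyperplane)
    have ae: "AE x in lebesgue. x \<in> wedge s t \<longrightarrow> has_laplacian V 0 x"
      by (rule eventually_mono[OF eventually_conj[OF lap off_line]]) (elim conjE, intro impI, rule V_lap; assumption)
    have "V (r *\<^sub>R dir \<theta>) = 0"
    proof (rule unique_continuation[OF \<open>C11_loc V\<close> ae open_wedge convex_wedge])
      show "open (wedge s t \<inter> wedge s b)" by (intro open_Int open_wedge)
      have "1 *\<^sub>R dir ((s + b) / 2) \<in> wedge s t \<inter> wedge s b"
        using s t \<theta> ord by (intro IntI in_wedgeI) auto
      then show "wedge s t \<inter> wedge s b \<noteq> {}" by blast
      show "r *\<^sub>R dir \<theta> \<in> wedge s t" using r \<theta> s t by (intro in_wedgeI) auto
    qed (auto intro: V0)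
    moreover have "sin (\<theta> - b) > 0" using \<theta> by (intro sin_gt_zero) auto
    ultimately show ?thesis
      using r by (simp add: V_def pos_square_def harmonic_match_def dir_inner_normal)
  qed
  \<comment> \<open>Only angles below \<open>b + pi\<close> are covered so far; the cap allows
    closing the interval before \<open>c < b + pi\<close> is known.\<close>
  define M where "M = min c (b + pi)"
  have "b < M" using ord by (simp add: M_def)
  have contu: "continuous_on UNIV u"
    by (intro continuous_at_imp_continuous_on ballI has_derivative_continuous[OF g[unfolded gderiv_def]])
  have contdir: "continuous_on A (\<lambda>t. r *\<^sub>R dir t)" for A r
    unfolding dir_def vector2_decomp by (intro continuous_intros)
  have closed_part: "u (r *\<^sub>R dir t) = harmonic_match a1 c1 b (r *\<^sub>R dir t)" if r: "r \<ge> 0" and t: "t \<in> {b..M}" for r t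
  proof (cases "r = 0")
    case True
    have "0 *\<^sub>R dir a \<in> sector a b" using ord by (intro in_sectorI) auto
    then have "u 0 = ?p1 0" using u1[of 0] by simp
    then show ?thesis using True by (simp add: harmonic_match_def)
  next
    case False
    have "u (r *\<^sub>R dir t) - harmonic_match a1 c1 b (r *\<^sub>R dir t) = 0"
    proof (rule continuous_constant_on_closure[where S = "{b<..<M}"
          and f = "\<lambda>t. u (r *\<^sub>R dir t) - harmonic_match a1 c1 b (r *\<^sub>R dir t)" and a = 0])
      show "continuous_on (closure {b<..<M}) (\<lambda>t. u (r *\<^sub>R dir t) - harmonic_match a1 c1 b (r *\<^sub>R dir t))"
        unfolding harmonic_match_dir
        by (intro continuous_intros continuous_on_compose2[OF contu contdir]) auto
      show "u (r *\<^sub>R dir t) - harmonic_match a1 c1 b (r *\<^sub>R dir t) = 0" if "t \<in> {b<..<M}" for t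
        using open_part[of r t] that r False by (auto simp: M_def)
      show "t \<in> closure {b<..<M}" using t \<open>b < M\<close> by simp
    qed
    then show ?thesis by simp
  qed
  \<comment> \<open>On the ray opposite to the edge \<open>b\<close> the correction term vanishes
    again, so \<open>u\<close> would touch \<open>p1\<close> outside its contact sector.\<close>
  have c_less: "c < b + pi"
  proof (rule ccontr)
    assume "\<not> c < b + pi"
    then have "u (1 *\<^sub>R dir (b + pi)) = harmonic_match a1 c1 b (1 *\<^sub>R dir (b + pi))"
      using ord by (intro closed_part) (auto simp: M_def)
    then have "u (1 *\<^sub>R dir (b + pi)) = ?p1 (1 *\<^sub>R dir (b + pi))"
      by (simp add: harmonic_match_def dir_inner_normal)
    then have "1 *\<^sub>R dir (b + pi) \<in> sector a b" by (simp only: u1)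
    then show False using notin_sector[of 1 b "b + pi" a] ord by auto
  qed
  show between: "u (r *\<^sub>R dir t) = harmonic_match a1 c1 b (r *\<^sub>R dir t)" if "r \<ge> 0" "t \<in> {b..c}" for r t
    using closed_part[of r t] that c_less by (simp add: M_def)
  define X Y where "X = (a1 - c1) + (a1 + c1) * cos (2 * b)" and "Y = (a1 + c1) * sin (2 * b)"
  define q where "q t = (X * cos (2 * t) + Y * sin (2 * t)) / 2" for t
  have uq: "u (dir t) = q t" if "t \<in> {b..c}" for t
    using between[of 1 t] that harmonic_match_dir[of a1 c1 b 1 t] by (simp add: q_def X_def Y_def)
  have p2: "?p2 (dir t) = ((a2 + c2) + (a2 - c2) * cos (2 * t)) / 2" for t
    using diag_form_dir[of a2 c2 1 t] by simp
  have touch: "u (dir c) = ?p2 (dir c)"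
    using u2[of "dir c"] in_sectorI[of 1 c c d] ord by simp
  have value_eq: "X * cos (2 * c) + Y * sin (2 * c) = (a2 + c2) + (a2 - c2) * cos (2 * c)"
    using touch uq[of c] ord by (simp add: p2 q_def)
  have "(dir has_derivative (\<lambda>h. vector [h * - sin c, h * cos c])) (at c)"
    unfolding dir_def by (intro has_derivative_vector2) (auto intro!: derivative_eq_intros)
  from has_derivative_compose[OF this g[of "dir c", unfolded gderiv_def]]
  have "((\<lambda>t. u (dir t)) has_derivative (\<lambda>h. vector [h * - sin c, h * cos c] \<bullet> g (dir c))) (at c)" .
  then have "((\<lambda>t. u (dir t)) has_real_derivative (- sin c * g (dir c) $ 1 + cos c * g (dir c) $ 2)) (at c)"
    unfolding has_field_derivative_def by (rule has_derivative_eq_rhs) (auto simp: inner_real2 algebra_simps)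
  then obtain D where D: "((\<lambda>t. u (dir t)) has_real_derivative D) (at c)" by blast
  have "(q has_real_derivative (- X * sin (2 * c) + Y * cos (2 * c))) (at c)"
    unfolding q_def by (auto intro!: derivative_eq_intros)
  \<comment> \<open>The formula \<open>q\<close> describes \<open>u\<close> only up to
    \<open>c\<close>, so derivatives are compared within \<open>{b..c}\<close>; differentiability of
    \<open>u\<close> at \<open>dir c\<close> identifies the one-sided derivative with
    \<open>D\<close>.\<close>
  then have "(q has_real_derivative (- X * sin (2 * c) + Y * cos (2 * c))) (at c within {b..c})"
    by (rule has_field_derivative_at_within)
  then have "((\<lambda>t. u (dir t)) has_real_derivative (- X * sin (2 * c) + Y * cos (2 * c))) (at c within {b..c})"
    unfolding has_field_derivative_def by (rule has_derivative_transform[rotated 2]) (use uq ord in auto)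
  then have D1: "D = - X * sin (2 * c) + Y * cos (2 * c)"
    using vector_derivative_unique_within_closed_interval[of b c c "\<lambda>t. u (dir t)"]
      has_field_derivative_at_within[OF D, of "{b..c}"] ord
    by (auto simp: has_real_derivative_iff_has_vector_derivative)
  \<comment> \<open>Along the circle \<open>?p2 - u\<close> is nonnegative and 0 at angle
    \<open>c\<close>, an interior minimum.\<close>
  have "((\<lambda>t. ?p2 (dir t) - u (dir t)) has_real_derivative (- (a2 - c2) * sin (2 * c) - D)) (at c)"
    unfolding p2 by (auto intro!: derivative_eq_intros D simp: field_simps)
  then have "- (a2 - c2) * sin (2 * c) - D = 0"
    by (rule DERIV_local_min[of _ _ _ 1]) (use bounds touch in auto)
  with D1 have deriv_eq: "- X * sin (2 * c) + Y * cos (2 * c) = - (a2 - c2) * sin (2 * c)" by simp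
  \<comment> \<open>\<open>value_eq\<close> and \<open>deriv_eq\<close> give the components of (X,
    Y) in the orthonormal frame (cos 2c, sin 2c), (- sin 2c, cos 2c); expanding in this frame
    recovers \<open>X\<close> and \<open>Y\<close>.\<close>
  have sc: "cos (2 * c) * cos (2 * c) = 1 - sin (2 * c) * sin (2 * c)"
    using sin_cos_squared_add[of "2 * c"] by (simp add: power2_eq_square)
  have "X = (X * cos (2 * c) + Y * sin (2 * c)) * cos (2 * c) - (- X * sin (2 * c) + Y * cos (2 * c)) * sin (2 * c)"
    using sc by algebra
  also have "\<dots> = (a2 - c2) + (a2 + c2) * cos (2 * c)"
    unfolding value_eq deriv_eq using sc by algebra
  finally show "(a1 - c1) + (a1 + c1) * cos (2 * b) = (a2 - c2) + (a2 + c2) * cos (2 * c)" by (simp add: X_def)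
  have "Y = (X * cos (2 * c) + Y * sin (2 * c)) * sin (2 * c) + (- X * sin (2 * c) + Y * cos (2 * c)) * cos (2 * c)"
    using sc by algebra
  also have "\<dots> = (a2 + c2) * sin (2 * c)"
    unfolding value_eq deriv_eq by (simp add: algebra_simps)
  finally show "(a1 + c1) * sin (2 * b) = (a2 + c2) * sin (2 * c)" by (simp add: Y_def)
qed

section \<open>Uniqueness of the solution with a given contact sector\<close>

lemma cone_configuration_first_angle_le:
  assumes u: "cone_configuration a1 c1 a2 c2 u a b c d" and v: "cone_configuration a1 c1 a2 c2 v a b c' d'"
  shows "c' \<le> c"
proof (rule ccontr)
  assume "\<not> c' \<le> c"
  note ord = u[unfolded cone_configuration_def] v[unfolded cone_configuration_def]
  \<comment> \<open>Up to angle \<open>c\<close> both functions are the same harmonic form, so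
    \<open>v\<close> would meet \<open>p2\<close> at angle \<open>c\<close>, before its own sector
    begins.\<close>
  have "v (1 *\<^sub>R dir c) = u (1 *\<^sub>R dir c)"
    using cone_configuration_between[OF u, of 1 c] cone_configuration_between[OF v, of 1 c] ord \<open>\<not> c' \<le> c\<close> by simp
  also have "1 *\<^sub>R dir c \<in> sector c d" using ord by (intro in_sectorI) auto
  then have "u (1 *\<^sub>R dir c) = diag_form a2 c2 (1 *\<^sub>R dir c)"
    using ord by blast
  finally have "1 *\<^sub>R dir c \<in> sector c' d'" using ord by blast
  then have "1 *\<^sub>R dir c \<in> sector (c' - 2 * pi) (d' - 2 * pi)"
    using sector_shift[of c' "-1" d'] by simp
  then show False
    using notin_sector[of 1 "d' - 2 * pi" c "c' - 2 * pi"] ord \<open>\<not> c' \<le> c\<close> by auto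
qed

text \<open>The edge \<open>c\<close> is determined by the preceding lemma and \<open>d\<close> by
  its reflected version. On the contact sectors \<open>u\<close> and \<open>v\<close> equal the
  obstacles, on the other two the same harmonic forms.\<close>

lemma cone_configuration_unique:
  assumes u: "cone_configuration a1 c1 a2 c2 u a b c d" and v: "cone_configuration a1 c1 a2 c2 v a b c' d'"
  shows "u = v"
proof
  fix x
  note ord = u[unfolded cone_configuration_def] v[unfolded cone_configuration_def]
  note u' = cone_configuration_reflect[OF u] and v' = cone_configuration_reflect[OF v]
  have "c' = c"
    using cone_configuration_first_angle_le[OF u v] cone_configuration_first_angle_le[OF v u] by simp
  have "d' = d"
    using cone_configuration_first_angle_le[OF u' v'] cone_configuration_first_angle_le[OF v' u'] by simp
  obtain r t where x: "r \<ge> 0" "a < t" "t \<le> a + 2 * pi" "x = r *\<^sub>R dir t"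
    by (rule polar_form)
  consider "t \<le> b" | "b \<le> t" "t \<le> c" | "c \<le> t" "t \<le> d" | "d \<le> t" by linarith
  then show "u x = v x"
  proof cases
    case 1
    then have "x \<in> sector a b" unfolding x(4) using x by (intro in_sectorI) auto
    then have "u x = diag_form a1 c1 x" "v x = diag_form a1 c1 x" using ord by blast+
    then show ?thesis by simp
  next
    case 2
    then show ?thesis
      using cone_configuration_between[OF u, of r t] cone_configuration_between[OF v, of r t] x \<open>c' = c\<close> by simp
  next
    case 3
    then have "x \<in> sector c d" unfolding x(4) using x by (intro in_sectorI) auto
    then have "u x = diag_form a2 c2 x" "v x = diag_form a2 c2 x" using ord \<open>c' = c\<close> \<open>d' = d\<close> by blast+
    then show ?thesis by simp
  next
    case 4
    have "reflection 0 (r *\<^sub>R dir (2 * pi - t)) = r *\<^sub>R dir (t + 2 * pi * of_int (- 1))"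
      by (simp add: reflection_dir)
    then have "reflection 0 (r *\<^sub>R dir (2 * pi - t)) = x"
      unfolding dir_plus_2pi by (simp add: x)
    then show ?thesis
      using cone_configuration_between[OF u', of r "2 * pi - t"] cone_configuration_between[OF v', of r "2 * pi - t"]
        x 4 \<open>d' = d\<close> by simp
  qed
qed

text \<open>This lets solutions be counted by their contact sets with \<open>p1\<close>. Both
  configurations are built on one pair of angles, since the set fixes them only up to full
  turns.\<close>

lemma double_cone_solution_unique:
  assumes "a1 < a2" "c1 < c2"
    and u: "double_cone_solution (diag_form a1 c1) (diag_form a2 c2) u"
    and v: "double_cone_solution (diag_form a1 c1) (diag_form a2 c2) v"
    and eq: "{x. u x = diag_form a1 c1 x} = {x. v x = diag_form a1 c1 x}"
  shows "u = v"
proof -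
  obtain a b where ab: "0 < b - a" "b - a < pi" "{x. u x = diag_form a1 c1 x} = sector a b"
    using u by (auto simp: double_cone_solution_def halfcone_iff_sector)
  then obtain c d where "cone_configuration a1 c1 a2 c2 u a b c d"
    using cone_configuration_exists[OF assms(1,2) u, of a b] by auto
  moreover obtain c' d' where "cone_configuration a1 c1 a2 c2 v a b c' d'"
    using cone_configuration_exists[OF assms(1,2) v, of a b] ab eq by auto
  ultimately show ?thesis by (rule cone_configuration_unique)
qed

section \<open>Edges of the contact sector as common points of two circles\<close>

text \<open>The complex number \<open>(a1 - c1) + (a1 + c1) * cis (2 * t)\<close> lies on the circle of centre
  \<open>a2 - c2\<close> and radius \<open>\<bar>a2 + c2\<bar>\<close>, so it also has the form
  \<open>(a2 - c2) + (a2 + c2) * cis (2 * s)\<close>.\<close>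

definition edge_condition :: "real \<Rightarrow> real \<Rightarrow> real \<Rightarrow> real \<Rightarrow> real \<Rightarrow> bool" where
  "edge_condition a1 c1 a2 c2 t \<longleftrightarrow>
    2 * ((a1 - c1) - (a2 - c2)) * (a1 + c1) * cos (2 * t) =
      (a2 + c2)\<^sup>2 - (a1 + c1)\<^sup>2 - ((a1 - c1) - (a2 - c2))\<^sup>2"

text \<open>Squaring and adding eliminates \<open>s\<close>: the squared distance of the common
  point from the second centre is the squared second radius.\<close>

lemma edge_conditionI:
  assumes "(a1 - c1) + (a1 + c1) * cos (2 * t) = (a2 - c2) + (a2 + c2) * cos (2 * s)"
    and "(a1 + c1) * sin (2 * t) = (a2 + c2) * sin (2 * s)"
  shows "edge_condition a1 c1 a2 c2 t"
proof -
  have circles: "2 * D * m * C = m'\<^sup>2 - m\<^sup>2 - D\<^sup>2"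
    if "D + m * C = m' * C'" "m * S = m' * S'" "S\<^sup>2 + C\<^sup>2 = 1" "S'\<^sup>2 + C'\<^sup>2 = 1" for D m m' C S C' S' :: real
  proof -
    have "(D + m * C)\<^sup>2 + (m * S)\<^sup>2 = m'\<^sup>2 * (S'\<^sup>2 + C'\<^sup>2)"
      unfolding that(1,2) by algebra
    moreover have "(D + m * C)\<^sup>2 + (m * S)\<^sup>2 = D\<^sup>2 + 2 * D * m * C + m\<^sup>2 * (S\<^sup>2 + C\<^sup>2)"
      by algebra
    ultimately show ?thesis unfolding that(3,4) by simp
  qed
  have "((a1 - c1) - (a2 - c2)) + (a1 + c1) * cos (2 * t) = (a2 + c2) * cos (2 * s)"
    using assms(1) by linarith
  from circles[OF this assms(2) sin_cos_squared_add sin_cos_squared_add]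
  show ?thesis unfolding edge_condition_def .
qed

text \<open>The reflected configuration has \<open>- a\<close> in the place of \<open>b\<close>, and
  the condition depends on the angle only through \<open>cos (2 * t)\<close>.\<close>

lemma cone_configuration_edges:
  assumes "cone_configuration a1 c1 a2 c2 u a b c d"
  shows "edge_condition a1 c1 a2 c2 a" "edge_condition a1 c1 a2 c2 b"
proof -
  show "edge_condition a1 c1 a2 c2 b"
    using cone_configuration_cos[OF assms] cone_configuration_sin[OF assms] by (rule edge_conditionI)
  have "edge_condition a1 c1 a2 c2 (- a)"
    using cone_configuration_cos[OF cone_configuration_reflect[OF assms]]
      cone_configuration_sin[OF cone_configuration_reflect[OF assms]] by (rule edge_conditionI)
  then show "edge_condition a1 c1 a2 c2 a" by (simp add: edge_condition_def)
qed

text \<open>Write \<open>m1\<close>, \<open>m2\<close> for the sums \<open>a1 + c1\<close>,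
  \<open>a2 + c2\<close> and \<open>D\<close> for the difference of the centres. Eliminating the
  cosine leaves a difference of squares with factors m2 + m1 - D, m2 - m1 + D, D + m1 - m2 and D +
  m1 + m2, that is 2 (c1 + a2), 2 (c2 - c1), 2 (a1 - a2) and 2 (a1 + c2).\<close>

lemma sin_squared_edge:
  assumes "edge_condition a1 c1 a2 c2 t"
  shows "4 * ((a1 - c1) - (a2 - c2))\<^sup>2 * (a1 + c1)\<^sup>2 * (sin (2 * t))\<^sup>2 =
    - 16 * (a2 - a1) * (c2 - c1) * ((a1 + c2) * (c1 + a2))"
proof -
  have "4 * ((a1 - c1) - (a2 - c2))\<^sup>2 * (a1 + c1)\<^sup>2 * (sin (2 * t))\<^sup>2 =
      4 * ((a1 - c1) - (a2 - c2))\<^sup>2 * (a1 + c1)\<^sup>2 - (2 * ((a1 - c1) - (a2 - c2)) * (a1 + c1) * cos (2 * t))\<^sup>2"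
    unfolding sin_squared_eq by algebra
  also have "\<dots> = 4 * ((a1 - c1) - (a2 - c2))\<^sup>2 * (a1 + c1)\<^sup>2 -
      ((a2 + c2)\<^sup>2 - (a1 + c1)\<^sup>2 - ((a1 - c1) - (a2 - c2))\<^sup>2)\<^sup>2"
    using assms by (simp only: edge_condition_def)
  also have "\<dots> = - 16 * (a2 - a1) * (c2 - c1) * ((a1 + c2) * (c1 + a2))"
    by algebra
  finally show ?thesis .
qed

lemma cos_eq_edges:
  assumes "edge_condition a1 c1 a2 c2 s" "edge_condition a1 c1 a2 c2 t"
    and "a1 + c1 \<noteq> 0" "a1 + c2 \<noteq> c1 + a2"
  shows "cos (2 * s) = cos (2 * t)"
proof -
  have "(a1 - c1) - (a2 - c2) \<noteq> 0" using assms(4) by linarith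
  moreover have "2 * ((a1 - c1) - (a2 - c2)) * (a1 + c1) * cos (2 * s) =
      2 * ((a1 - c1) - (a2 - c2)) * (a1 + c1) * cos (2 * t)"
    using assms(1,2) by (simp only: edge_condition_def)
  ultimately show ?thesis
    using assms(3) by simp
qed

text \<open>If the coefficients of \<open>P\<close> are equal, the circles are concentric, and a
  common point forces equal radii and thus both coefficients to be 0. Otherwise the sines of the
  doubled edge angles vanish and the cosines agree, so \<open>b - a\<close> would be a multiple of
  \<open>pi\<close>.\<close>

lemma no_double_cone_solution:
  assumes lt: "a1 < a2" "c1 < c2" and m: "a1 + c1 < 0" "a2 + c2 > 0"
    and sign: "(a1 + c2) * (c1 + a2) \<ge> 0" and nz: "a1 + c2 \<noteq> 0 \<or> c1 + a2 \<noteq> 0"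
  shows "\<not> double_cone_solution (diag_form a1 c1) (diag_form a2 c2) u"
proof
  assume sol: "double_cone_solution (diag_form a1 c1) (diag_form a2 c2) u"
  obtain a b where ab: "0 < b - a" "b - a < pi" "{x. u x = diag_form a1 c1 x} = sector a b"
    using sol by (auto simp: double_cone_solution_def halfcone_iff_sector)
  then obtain c d where conf: "cone_configuration a1 c1 a2 c2 u a b c d"
    using cone_configuration_exists[OF lt sol, of a b] by auto
  note edges = cone_configuration_edges[OF conf]
  have ne: "a1 + c2 \<noteq> c1 + a2"
  proof
    assume eq: "a1 + c2 = c1 + a2"
    then have "(a1 - c1) - (a2 - c2) = 0" by linarith
    then have "(a2 + c2)\<^sup>2 = (a1 + c1)\<^sup>2" using edges(1) by (simp add: edge_condition_def)
    then have "a2 + c2 = - (a1 + c1)" using m by (simp add: power2_eq_iff)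
    then show False using eq nz by linarith
  qed
  have sin0: "sin (2 * t) = 0" if "edge_condition a1 c1 a2 c2 t" for t
  proof -
    have "16 * (a2 - a1) * (c2 - c1) * ((a1 + c2) * (c1 + a2)) \<ge> 0"
      using lt sign by simp
    then have "4 * ((a1 - c1) - (a2 - c2))\<^sup>2 * (a1 + c1)\<^sup>2 * (sin (2 * t))\<^sup>2 \<le> 0"
      using sin_squared_edge[OF that] by linarith
    also have "4 * ((a1 - c1) - (a2 - c2))\<^sup>2 * (a1 + c1)\<^sup>2 * (sin (2 * t))\<^sup>2 =
        (2 * ((a1 - c1) - (a2 - c2)) * (a1 + c1) * sin (2 * t))\<^sup>2"
      by algebra
    finally have "2 * ((a1 - c1) - (a2 - c2)) * (a1 + c1) * sin (2 * t) = 0"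
      by (simp only: power2_less_eq_zero_iff)
    moreover have "(a1 - c1) - (a2 - c2) \<noteq> 0" using ne by linarith
    ultimately show ?thesis using m by simp
  qed
  have "cos (2 * a) = cos (2 * b)"
    using cos_eq_edges[OF edges] m ne by simp
  then have "cos (2 * (b - a)) = (cos (2 * a))\<^sup>2"
    using sin0[OF edges(1)] by (simp add: right_diff_distrib cos_diff power2_eq_square)
  also have "\<dots> = 1" using sin_cos_squared_add[of "2 * a"] sin0[OF edges(1)] by simp
  finally have "sin (b - a) = 0" using cos_double_sin[of "b - a"] by simp
  then show False using sin_gt_zero[of "b - a"] ab by simp
qed

text \<open>Each edge has angle \<open>\<alpha>\<close> or \<open>- \<alpha>\<close> modulo
  \<open>pi\<close>. The bound on the opening rules out equal signs and fixes the multiples of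
  \<open>pi\<close> relative to each other. The mixed cases are sectors around the first and the
  second axis; the parity of \<open>n\<close> selects the side.\<close>

lemma contact_sector_cases:
  assumes \<alpha>: "0 < \<alpha>" "\<alpha> < pi / 2" and ab: "a < b" "b < a + pi"
    and cos: "cos (2 * a) = cos (2 * \<alpha>)" "cos (2 * b) = cos (2 * \<alpha>)"
  shows "sector a b \<in> {sector (- \<alpha>) \<alpha>, sector (pi - \<alpha>) (pi + \<alpha>), sector \<alpha> (pi - \<alpha>), sector (pi + \<alpha>) (2 * pi - \<alpha>)}"
proof -
  have angle: "\<exists>n::int. t = \<alpha> + pi * n \<or> t = - \<alpha> + pi * n" if t: "cos (2 * t) = cos (2 * \<alpha>)" for t
  proof -
    obtain n where "n \<in> \<int>" "2 * t = 2 * \<alpha> + 2 * n * pi \<or> 2 * t = - (2 * \<alpha>) + 2 * n * pi"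
      using t unfolding cos_eq by blast
    then obtain k :: int where "2 * t = 2 * \<alpha> + 2 * k * pi \<or> 2 * t = - (2 * \<alpha>) + 2 * k * pi"
      by (auto elim: Ints_cases)
    then have "t = \<alpha> + pi * k \<or> t = - \<alpha> + pi * k" by (auto simp: mult.commute)
    then show ?thesis by blast
  qed
  obtain n k :: int where n: "a = \<alpha> + pi * n \<or> a = - \<alpha> + pi * n" and k: "b = \<alpha> + pi * k \<or> b = - \<alpha> + pi * k"
    using angle cos by metis
  have int_bound: "i < j" if "pi * of_int i < pi * of_int j" for i j :: int
    using that by simp
  have parity: "\<exists>i::int. n = 2 * i \<or> n = 2 * i + 1" by presburger
  then obtain i :: int where i: "n = 2 * i \<or> n = 2 * i + 1" by blast
  have shift: "sector (s + pi * n) (t + pi * n) = (if n = 2 * i then sector s t else sector (s + pi) (t + pi))" for s t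
    using i sector_shift[of s i t] sector_shift[of "s + pi" i "t + pi"] by (auto simp: algebra_simps)
  consider (same) "b - a = pi * of_int (k - n)"
    | (acute) "a = - \<alpha> + pi * n" "b = \<alpha> + pi * k" | (obtuse) "a = \<alpha> + pi * n" "b = - \<alpha> + pi * k"
    using n k by (auto simp: algebra_simps)
  then show ?thesis
  proof cases
    case same
    have "pi * of_int 0 < pi * of_int (k - n)" "pi * of_int (k - n) < pi * of_int 1"
      unfolding same[symmetric] using ab by simp_all
    then have "0 < k - n" "k - n < 1" by (blast dest: int_bound)+
    then show ?thesis by simp
  next
    case acute
    then have "pi * of_int n < pi * of_int (k + 1)" "pi * of_int k < pi * of_int (n + 1)"
      using ab \<alpha> by (auto simp: distrib_left)
    then have "n = k" using int_bound[of n "k + 1"] int_bound[of k "n + 1"] by simp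
    then show ?thesis using acute shift[of "- \<alpha>" \<alpha>] by (simp add: add.commute)
  next
    case obtuse
    then have "pi * of_int n < pi * of_int k" "pi * of_int k < pi * of_int n + pi * 2"
      using ab \<alpha> by linarith+
    moreover have "pi * of_int (n + 2) = pi * of_int n + pi * 2" by (simp add: distrib_left)
    ultimately have "pi * of_int n < pi * of_int k" "pi * of_int k < pi * of_int (n + 2)" by simp_all
    then have "k = n + 1" using int_bound[of n k] int_bound[of k "n + 2"] by simp
    then have "b = (pi - \<alpha>) + pi * n" using obtuse by (simp add: algebra_simps)
    then have "sector a b = (if n = 2 * i then sector \<alpha> (pi - \<alpha>) else sector (\<alpha> + pi) ((pi - \<alpha>) + pi))"
      unfolding obtuse(1) by (simp only: shift)
    moreover have "\<alpha> + pi = pi + \<alpha>" "(pi - \<alpha>) + pi = 2 * pi - \<alpha>" by simp_all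
    ultimately show ?thesis by (simp add: add.commute)
  qed
qed

section \<open>Construction of solutions\<close>

text \<open>For points on opposite sides, the segment between them meets the hyperplane at a point
  \<open>z\<close> where the gradients agree, and the two Lipschitz estimates add up without loss. A
  ball replaces the compact set so that \<open>z\<close> stays where these estimates hold.\<close>

lemma C11_loc_glue:
  fixes n :: "'a::euclidean_space"
  assumes U: "\<And>x. GDERIV U x :> g x" "\<And>K. compact K \<Longrightarrow> \<exists>L. L-lipschitz_on K g"
    and W: "\<And>x. GDERIV W x :> h x" "\<And>K. compact K \<Longrightarrow> \<exists>L. L-lipschitz_on K h"
    and match: "\<And>x. x \<bullet> n = 0 \<Longrightarrow> U x = W x \<and> g x = h x"
  shows "C11_loc (\<lambda>x. if x \<bullet> n \<ge> 0 then U x else W x)"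
proof -
  define S T where "S = {x. x \<bullet> n \<ge> 0}" and "T = {x. x \<bullet> n \<le> 0}"
  define k where "k x = (if x \<bullet> n \<ge> 0 then g x else h x)" for x
  have closed: "closed S" "closed T"
    unfolding S_def T_def inner_commute[of _ n] by (rule closed_halfspace_ge closed_halfspace_le)+
  have "GDERIV (\<lambda>x. if x \<bullet> n \<ge> 0 then U x else W x) x :> k x" for x
  proof -
    have "((\<lambda>x. if x \<in> S then U x else W x) has_derivative
        (if x \<in> S then (\<lambda>v. v \<bullet> g x) else (\<lambda>v. v \<bullet> h x))) (at x within S \<union> T)"
      by (rule has_derivative_If_within_closures)
        (use U(1)[unfolded gderiv_def] W(1)[unfolded gderiv_def] match closed in
          \<open>auto simp: closure_closed S_def T_def intro: has_derivative_at_withinI\<close>)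
    moreover have "S \<union> T = UNIV" by (auto simp: S_def T_def)
    ultimately show ?thesis
      by (cases "x \<in> S") (simp_all add: gderiv_def k_def S_def)
  qed
  moreover have "\<exists>L. L-lipschitz_on K k" if K: "compact K" for K
  proof -
    obtain r where r: "K \<subseteq> cball 0 r"
      using compact_imp_bounded[OF K] by (auto simp: bounded_iff subset_iff)
    obtain L1 L2 where L1: "L1-lipschitz_on (cball 0 r) g" and L2: "L2-lipschitz_on (cball 0 r) h"
      using U(2)[OF compact_cball] W(2)[OF compact_cball] by metis
    define L where "L = max L1 L2"
    have L: "L-lipschitz_on (cball 0 r) g" "L-lipschitz_on (cball 0 r) h"
      using lipschitz_on_le[OF L1, of L] lipschitz_on_le[OF L2, of L] by (auto simp: L_def)
    have cross: "dist (g x) (h y) \<le> L * dist x y"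
      if x: "x \<in> cball 0 r" "x \<bullet> n \<ge> 0" and y: "y \<in> cball 0 r" "y \<bullet> n < 0" for x y
    proof -
      define s where "s = (x \<bullet> n) / (x \<bullet> n - y \<bullet> n)"
      have s: "0 \<le> s" "s \<le> 1" using x y by (auto simp: s_def divide_simps)
      define z where "z = (1 - s) *\<^sub>R x + s *\<^sub>R y"
      have z: "z \<in> cball 0 r"
        unfolding z_def using convex_cball[of 0 r] x y s by (intro convexD) auto
      have "s * (x \<bullet> n - y \<bullet> n) = x \<bullet> n" using x y by (simp add: s_def)
      then have "z \<bullet> n = 0" by (simp add: z_def inner_add_left algebra_simps)
      have "x - z = s *\<^sub>R (x - y)" "z - y = (1 - s) *\<^sub>R (x - y)"
        by (simp_all add: z_def algebra_simps)
      then have d: "dist x z = s * dist x y" "dist z y = (1 - s) * dist x y"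
        using s by (simp_all add: dist_norm)
      have "dist (g x) (h y) \<le> dist (g x) (g z) + dist (h z) (h y)"
        using match[OF \<open>z \<bullet> n = 0\<close>] dist_triangle[of "g x" "h y" "g z"] by simp
      also have "\<dots> \<le> L * dist x z + L * dist z y"
        using x y z by (intro add_mono lipschitz_onD[OF L(1)] lipschitz_onD[OF L(2)])
      also have "\<dots> = L * dist x y" by (simp add: d algebra_simps)
      finally show ?thesis .
    qed
    have "L-lipschitz_on (cball 0 r) k"
    proof (rule lipschitz_onI)
      show "dist (k x) (k y) \<le> L * dist x y" if "x \<in> cball 0 r" "y \<in> cball 0 r" for x y
        using that cross[of x y] cross[of y x] lipschitz_onD[OF L(1), of x y] lipschitz_onD[OF L(2), of x y]
        by (cases "x \<bullet> n \<ge> 0"; cases "y \<bullet> n \<ge> 0") (simp_all add: k_def dist_commute)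
      show "0 \<le> L" using L(1) by (rule lipschitz_on_nonneg)
    qed
    then show ?thesis using r lipschitz_on_subset by blast
  qed
  ultimately show ?thesis
    unfolding C11_loc_def by (intro exI[of _ k]) simp
qed

text \<open>For angles of modulus at most \<open>pi\<close>, membership is the sign condition
  \<open>sin (\<bar>t\<bar> - \<alpha>) \<le> 0\<close>. Its expansion is the Cartesian form in
  which the contact sets of the constructed solution appear.\<close>

lemma sector_symmetric_iff:
  assumes "0 < \<alpha>" "\<alpha> < pi / 2"
  shows "x \<in> sector (- \<alpha>) \<alpha> \<longleftrightarrow> \<bar>x $ 2\<bar> * cos \<alpha> \<le> x $ 1 * sin \<alpha>"
proof -
  obtain r t where x: "r \<ge> 0" "- pi < t" "t \<le> - pi + 2 * pi" "x = r *\<^sub>R dir t"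
    by (rule polar_form)
  show ?thesis
  proof (cases "r = 0")
    case True
    then show ?thesis using x in_sectorI[of 0 0 "- \<alpha>" \<alpha>] assms by simp
  next
    case False
    then have "r > 0" using x by simp
    have sin_abs: "\<bar>sin t\<bar> = sin \<bar>t\<bar>"
      using x sin_ge_zero[of "\<bar>t\<bar>"] by (cases "t \<ge> 0") auto
    have "x \<in> sector (- \<alpha>) \<alpha> \<longleftrightarrow> \<bar>t\<bar> \<le> \<alpha>"
    proof
      assume "x \<in> sector (- \<alpha>) \<alpha>"
      then have "\<not> \<alpha> < t" "\<not> t < - \<alpha>"
        using notin_sector[of r \<alpha> t "- \<alpha>"] notin_sector[of r "\<alpha> - 2 * pi" t "- \<alpha> - 2 * pi"]
          sector_shift[of "- \<alpha>" "-1" \<alpha>] x \<open>r > 0\<close> assms by auto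
      then show "\<bar>t\<bar> \<le> \<alpha>" by linarith
    next
      assume "\<bar>t\<bar> \<le> \<alpha>"
      then show "x \<in> sector (- \<alpha>) \<alpha>" unfolding x(4) using x(1) by (intro in_sectorI) auto
    qed
    also have "\<dots> \<longleftrightarrow> sin (\<bar>t\<bar> - \<alpha>) \<le> 0"
    proof
      assume "\<bar>t\<bar> \<le> \<alpha>"
      then have "0 \<le> sin (\<alpha> - \<bar>t\<bar>)" using assms x by (intro sin_ge_zero) auto
      then show "sin (\<bar>t\<bar> - \<alpha>) \<le> 0" by (simp add: sin_diff mult.commute)
    next
      assume "sin (\<bar>t\<bar> - \<alpha>) \<le> 0"
      moreover have "\<bar>t\<bar> \<le> pi" using x by simp
      ultimately show "\<bar>t\<bar> \<le> \<alpha>"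
        using sin_gt_zero[of "\<bar>t\<bar> - \<alpha>"] assms by linarith
    qed
    also have "\<dots> \<longleftrightarrow> \<bar>sin t\<bar> * cos \<alpha> \<le> cos t * sin \<alpha>"
      by (simp add: sin_diff sin_abs)
    also have "\<dots> \<longleftrightarrow> \<bar>x $ 2\<bar> * cos \<alpha> \<le> x $ 1 * sin \<alpha>"
      using \<open>r > 0\<close> mult_le_cancel_left_pos[of r "\<bar>sin t\<bar> * cos \<alpha>" "cos t * sin \<alpha>"]
      by (simp add: x abs_mult mult.assoc)
    finally show ?thesis .
  qed
qed

lemma sector_opposite_iff:
  assumes "0 < \<gamma>" "\<gamma> < pi / 2"
  shows "x \<in> sector (pi - \<gamma>) (pi + \<gamma>) \<longleftrightarrow> \<bar>x $ 2\<bar> * cos \<gamma> \<le> - x $ 1 * sin \<gamma>"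
proof -
  have "x \<in> sector (pi - \<gamma>) (pi + \<gamma>) \<longleftrightarrow> reflection pi x \<in> sector (- \<gamma>) \<gamma>"
    using reflection_sector[of pi "- \<gamma>" \<gamma>] by auto
  then show ?thesis using sector_symmetric_iff[OF assms] by simp
qed

text \<open>The matching hypotheses are the circle equations for the edges \<open>\<alpha>\<close>
  and \<open>pi - \<gamma>\<close>, whence the minus sign in \<open>match_sin\<close>. They identify
  the harmonic forms matched to the two obstacles; the common form lies above \<open>p1\<close>
  because \<open>a1 + c1 < 0\<close> and below \<open>p2\<close> because
  \<open>a2 + c2 > 0\<close>.\<close>

lemma double_cone_solution_construct:
  assumes m: "a1 + c1 < 0" "a2 + c2 > 0" and lt: "a1 < a2" "c1 < c2"
    and \<alpha>: "0 < \<alpha>" "\<alpha> < pi / 2" and \<gamma>: "0 < \<gamma>" "\<gamma> < pi / 2"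
    and match_cos: "(a1 - c1) + (a1 + c1) * cos (2 * \<alpha>) = (a2 - c2) + (a2 + c2) * cos (2 * \<gamma>)"
    and match_sin: "(a1 + c1) * sin (2 * \<alpha>) = - (a2 + c2) * sin (2 * \<gamma>)"
  obtains u where "double_cone_solution (diag_form a1 c1) (diag_form a2 c2) u"
    and "{x. u x = diag_form a1 c1 x} = sector (- \<alpha>) \<alpha>"
proof -
  let ?p1 = "diag_form a1 c1" and ?p2 = "diag_form a2 c2"
  let ?\<rho> = "reflection 0"
  define n1 n2 where "n1 = normal \<alpha>" and "n2 = normal (pi - \<gamma>)"
  define e where "e = (axis 2 1 :: real^2)"
  \<comment> \<open>On the upper half plane, \<open>U\<close> is \<open>p1\<close> for angles up to \<open>\<alpha>\<close>, harmonic between \<open>\<alpha>\<close> and \<open>pi - \<gamma>\<close>, and \<open>p2\<close>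
    beyond; the solution is its even extension.\<close>
  define U where "U x = ?p1 x + (- (a1 + c1) * pos_square n1 x + (a2 + c2) * pos_square n2 x)" for x
  define u where "u x = (if x \<bullet> e \<ge> 0 then U x else (U \<circ> ?\<rho>) x)" for x
  have e: "x \<bullet> e = x $ 2" for x by (simp add: e_def inner_axis)
  have trig: "sin \<alpha> > 0" "cos \<alpha> > 0" "sin \<gamma> > 0" "cos \<gamma> > 0"
    using \<alpha> \<gamma> by (auto intro!: sin_gt_zero cos_gt_zero_pi)
  have l1: "x \<bullet> n1 = x $ 2 * cos \<alpha> - x $ 1 * sin \<alpha>" and l2: "x \<bullet> n2 = - x $ 1 * sin \<gamma> - x $ 2 * cos \<gamma>" for x
    by (simp_all add: n1_def n2_def inner_real2 sin_diff cos_diff)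
  have harmonic: "?p1 x - (a1 + c1) * (x \<bullet> n1)\<^sup>2 = ?p2 x - (a2 + c2) * (x \<bullet> n2)\<^sup>2" for x
  proof -
    obtain r t where x: "x = r *\<^sub>R dir t" using polar_form by metis
    have trig: "cos (2 * (pi - \<gamma>)) = cos (2 * \<gamma>)" "sin (2 * (pi - \<gamma>)) = - sin (2 * \<gamma>)"
      by (simp_all add: right_diff_distrib cos_diff sin_diff)
    have "harmonic_match a1 c1 \<alpha> x = harmonic_match a2 c2 (pi - \<gamma>) x"
      unfolding x harmonic_match_dir trig match_cos match_sin by (simp add: algebra_simps)
    then show ?thesis by (simp add: harmonic_match_def n1_def n2_def)
  qed
  \<comment> \<open>In the upper half plane the \<open>p1\<close> region has nonnegative and the
    \<open>p2\<close> region nonpositive first coordinate, so the line of \<open>n1\<close> is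
    crossed before that of \<open>n2\<close>.\<close>
  have neg1: "x \<bullet> n1 \<le> 0 \<Longrightarrow> x \<bullet> n2 \<le> 0" and pos2: "x \<bullet> n2 \<ge> 0 \<Longrightarrow> x \<bullet> n1 \<ge> 0" if "x $ 2 \<ge> 0" for x :: "real^2"
  proof -
    have nonneg: "x $ 2 * cos \<alpha> \<ge> 0" "x $ 2 * cos \<gamma> \<ge> 0" using that trig by simp_all
    { assume "x \<bullet> n1 \<le> 0"
      then have "x $ 1 * sin \<alpha> \<ge> 0" using nonneg by (simp add: l1)
      then have "x $ 1 * sin \<gamma> \<ge> 0" using trig by (simp add: zero_le_mult_iff)
      then show "x \<bullet> n2 \<le> 0" using nonneg by (simp add: l2) }
    { assume "x \<bullet> n2 \<ge> 0"
      then have "x $ 1 * sin \<gamma> \<le> 0" using nonneg by (simp add: l2)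
      then have "x $ 1 * sin \<alpha> \<le> 0" using trig by (simp add: mult_le_0_iff)
      then show "x \<bullet> n1 \<ge> 0" using nonneg by (simp add: l1) }
  qed
  have U_regions: "U x = ?p1 x" if "x $ 2 \<ge> 0" "x \<bullet> n1 \<le> 0" for x :: "real^2"
    using that neg1[of x] by (simp add: U_def pos_square_def)
  have U_middle: "U x = ?p1 x - (a1 + c1) * (x \<bullet> n1)\<^sup>2" if "x \<bullet> n1 \<ge> 0" "x \<bullet> n2 \<le> 0" for x
    using that by (simp add: U_def pos_square_def algebra_simps)
  have U_far: "U x = ?p2 x" if "x $ 2 \<ge> 0" "x \<bullet> n2 \<ge> 0" for x :: "real^2"
    using that pos2[of x] harmonic[of x] by (simp add: U_def pos_square_def algebra_simps)
  have U_cases: "?p1 x \<le> U x \<and> U x \<le> ?p2 x \<and> (U x = ?p1 x \<longleftrightarrow> x \<bullet> n1 \<le> 0) \<and> (U x = ?p2 x \<longleftrightarrow> x \<bullet> n2 \<ge> 0)"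
    if x: "x $ 2 \<ge> 0" for x :: "real^2"
  proof -
    have p12: "?p1 x \<le> ?p2 x" using diag_form_less[OF lt, of x] by (cases "x = 0") (auto simp: diag_form_def)
    consider "x \<bullet> n1 \<le> 0" | "x \<bullet> n1 > 0" "x \<bullet> n2 < 0" | "x \<bullet> n2 \<ge> 0" by linarith
    then show ?thesis
    proof cases
      case 1
      have "U x = ?p2 x \<longleftrightarrow> x \<bullet> n2 \<ge> 0"
      proof
        assume "U x = ?p2 x"
        then have "x = 0" using U_regions[OF x 1] diag_form_less[OF lt, of x] by fastforce
        then show "x \<bullet> n2 \<ge> 0" by simp
      qed (use U_far x in simp)
      then show ?thesis using U_regions[OF x 1] p12 1 by simp
    next
      case 2
      have "(a1 + c1) * (x \<bullet> n1)\<^sup>2 < 0" "(a2 + c2) * (x \<bullet> n2)\<^sup>2 > 0"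
        using m 2 by (simp_all add: mult_neg_pos)
      then show ?thesis using U_middle[of x] harmonic[of x] 2 m by simp
    next
      case 3
      have "U x = ?p1 x \<longleftrightarrow> x \<bullet> n1 \<le> 0"
      proof
        assume "U x = ?p1 x"
        then have "x = 0" using U_far[OF x 3] diag_form_less[OF lt, of x] by fastforce
        then show "x \<bullet> n1 \<le> 0" by simp
      qed (use U_regions x in simp)
      then show ?thesis using U_far[OF x 3] p12 3 by simp
    qed
  qed
  have p_\<rho>: "diag_form a c (?\<rho> x) = diag_form a c x" for a c x by (simp add: diag_form_def)
  have bounds: "?p1 x \<le> u x \<and> u x \<le> ?p2 x" for x
    using U_cases[of x] U_cases[of "?\<rho> x"] by (simp add: u_def e p_\<rho>)
  have contact1: "{x. u x = ?p1 x} = sector (- \<alpha>) \<alpha>"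
    using U_cases U_cases[of "?\<rho> _"] sector_symmetric_iff[OF \<alpha>]
    by (auto simp: u_def e p_\<rho> l1 not_le)
  have contact2: "{x. u x = ?p2 x} = sector (pi - \<gamma>) (pi + \<gamma>)"
    using U_cases U_cases[of "?\<rho> _"] sector_opposite_iff[OF \<gamma>]
    by (auto simp: u_def e p_\<rho> l2 not_le)
  define g where "g x = vector [2 * a1 * x $ 1, 2 * c1 * x $ 2] +
    (- (a1 + c1) *\<^sub>R ((2 * max 0 (x \<bullet> n1)) *\<^sub>R n1) + (a2 + c2) *\<^sub>R ((2 * max 0 (x \<bullet> n2)) *\<^sub>R n2))" for x
  have U_g: "GDERIV U x :> g x" for x
    unfolding U_def g_def by (intro GDERIV_add GDERIV_cmult GDERIV_diag_form GDERIV_pos_square)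
  have "C11_loc U"
    unfolding U_def by (intro C11_loc_add C11_loc_cmult C11_loc_diag_form C11_loc_pos_square)
  then obtain g' where "\<And>x. GDERIV U x :> g' x" "\<And>K. compact K \<Longrightarrow> \<exists>L. L-lipschitz_on K g'"
    unfolding C11_loc_def by metis
  moreover from this have "g' = g" using gderiv_unique[OF _ U_g] by blast
  ultimately have g_lip: "\<And>K. compact K \<Longrightarrow> \<exists>L. L-lipschitz_on K g" by blast
  have "C11_loc (U \<circ> ?\<rho>)"
    using C11_loc_compose_involution[OF orthogonal_reflection reflection_reflection \<open>C11_loc U\<close>] .
  then obtain h where h: "\<And>x. GDERIV (U \<circ> ?\<rho>) x :> h x" "\<And>K. compact K \<Longrightarrow> \<exists>L. L-lipschitz_on K h"
    unfolding C11_loc_def by metis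
  have h_eq: "h x = ?\<rho> (g (?\<rho> x))" for x
  proof (rule gderiv_unique[OF h(1)])
    have "(?\<rho> has_derivative ?\<rho>) (at x)"
      by (intro linear_imp_has_derivative orthogonal_transformation_linear orthogonal_reflection)
    from has_derivative_compose[OF this U_g[of "?\<rho> x", unfolded gderiv_def]]
    show "GDERIV (U \<circ> ?\<rho>) x :> ?\<rho> (g (?\<rho> x))"
      unfolding gderiv_def o_def by (rule has_derivative_eq_rhs) (auto simp: inner_real2)
  qed
  have "C11_loc u"
    unfolding u_def
  proof (rule C11_loc_glue[OF U_g g_lip h])
    fix x assume "x \<bullet> e = 0"
    then have x2: "x $ 2 = 0" by (simp add: e)
    have \<rho>x: "?\<rho> x = x" using x2 by (intro vector2_eqI) simp_all
    \<comment> \<open>The even extension fits if the vertical derivative of \<open>U\<close>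
      vanishes on the axis. On the positive half-axis both squares are switched off; on the negative
      one the condition is \<open>match_sin\<close>, rewritten in half angles.\<close>
    have sc: "(a1 + c1) * (sin \<alpha> * cos \<alpha>) = - (a2 + c2) * (sin \<gamma> * cos \<gamma>)"
      using match_sin by (simp add: sin_double)
    have max: "max 0 (x \<bullet> n1) = max 0 (- x $ 1) * sin \<alpha>" "max 0 (x \<bullet> n2) = max 0 (- x $ 1) * sin \<gamma>"
      using trig x2 by (auto simp: l1 l2 max_def zero_le_mult_iff mult_le_0_iff)
    have "g x $ 2 = - 2 * max 0 (- x $ 1) * ((a1 + c1) * (sin \<alpha> * cos \<alpha>) + (a2 + c2) * (sin \<gamma> * cos \<gamma>))"
      unfolding g_def max by (simp add: x2 n1_def n2_def cos_diff algebra_simps)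
    moreover have "(a1 + c1) * (sin \<alpha> * cos \<alpha>) + (a2 + c2) * (sin \<gamma> * cos \<gamma>) = 0"
      using sc unfolding mult_minus_left by linarith
    ultimately have "g x $ 2 = 0" by simp
    then have "?\<rho> (g x) = g x" by (intro vector2_eqI) simp_all
    then show "U x = (U \<circ> ?\<rho>) x \<and> g x = h x" by (simp add: \<rho>x h_eq)
  qed
  have U_lap: "has_laplacian U (laplacian ?p1 x * indicator {y. u y = ?p1 y} x +
         laplacian ?p2 x * indicator {y. u y = ?p2 y} x) x"
    if x: "x $ 2 > 0" "x \<bullet> n1 \<noteq> 0" "x \<bullet> n2 \<noteq> 0" for x :: "real^2"
  proof -
    have ux: "u x = U x" using x by (simp add: u_def e)
    note U_x = U_cases[OF less_imp_le[OF x(1)]]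
    \<comment> \<open>The Laplacian starts as \<open>2 * (a1 + c1)\<close>, becomes 0 once the first
      square is switched on, and \<open>2 * (a2 + c2)\<close> once the second is as well.\<close>
    have sum: "has_laplacian U (2 * (a1 + c1) + (- (a1 + c1) * l + (a2 + c2) * l')) x"
      if "has_laplacian (pos_square n1) l x" "has_laplacian (pos_square n2) l' x" for l l'
      unfolding U_def by (intro has_laplacian_add has_laplacian_cmult has_laplacian_diag_form that)
    have self: "n1 \<bullet> n1 = 1" "n2 \<bullet> n2 = 1" by (simp_all add: n1_def n2_def)
    have lap: "laplacian (diag_form a c) x = 2 * (a + c)" for a c
      by (rule laplacian_eqI[OF has_laplacian_diag_form])
    consider "x \<bullet> n1 < 0" "x \<bullet> n2 < 0" | "x \<bullet> n1 > 0" "x \<bullet> n2 < 0" | "x \<bullet> n1 > 0" "x \<bullet> n2 > 0"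
      using x neg1[of x] by linarith
    then show ?thesis
    proof cases
      case 1
      then show ?thesis
        using sum[OF has_laplacian_pos_square_neg has_laplacian_pos_square_neg] U_x by (simp add: ux lap)
    next
      case 2
      then show ?thesis
        using sum[OF has_laplacian_pos_square_pos has_laplacian_pos_square_neg] U_x by (simp add: ux lap self)
    next
      case 3
      then show ?thesis
        using sum[OF has_laplacian_pos_square_pos has_laplacian_pos_square_pos] U_x
        by (simp add: ux lap self algebra_simps)
    qed
  qed
  have u_\<rho>: "u (?\<rho> x) = u x" for x
  proof (cases "x $ 2 = 0")
    case True
    then have "?\<rho> x = x" by (intro vector2_eqI) simp_all
    then show ?thesis by simp
  qed (auto simp: u_def e)
  have u_lap: "has_laplacian u (laplacian ?p1 x * indicator {y. u y = ?p1 y} x +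
         laplacian ?p2 x * indicator {y. u y = ?p2 y} x) x"
    if x: "x \<bullet> e \<noteq> 0" "x \<bullet> n1 \<noteq> 0" "x \<bullet> n2 \<noteq> 0" "x \<bullet> ?\<rho> n1 \<noteq> 0" "x \<bullet> ?\<rho> n2 \<noteq> 0" for x
  proof (cases "x $ 2 > 0")
    case True
    have "open {x. x \<bullet> e > 0}" unfolding inner_commute[of _ e] by (rule open_halfspace_gt)
    then show ?thesis
      by (rule has_laplacian_open_transform[OF U_lap[OF True x(2,3)]]) (use True in \<open>auto simp: u_def e\<close>)
  next
    case False
    then have x2: "x $ 2 < 0" using x(1) by (simp add: e)
    have "?\<rho> x \<bullet> n1 \<noteq> 0" "?\<rho> x \<bullet> n2 \<noteq> 0" using x(4,5) by (simp_all add: inner_real2)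
    from U_lap[OF _ this] x2
    have "has_laplacian (U \<circ> ?\<rho>) (laplacian ?p1 (?\<rho> x) * indicator {y. u y = ?p1 y} (?\<rho> x) +
         laplacian ?p2 (?\<rho> x) * indicator {y. u y = ?p2 y} (?\<rho> x)) x"
      by (intro has_laplacian_compose_involution[OF orthogonal_reflection reflection_reflection]) simp
    moreover have "laplacian (diag_form a c) (?\<rho> x) = laplacian (diag_form a c) x" for a c
      by (simp add: laplacian_eqI[OF has_laplacian_diag_form])
    ultimately have lap: "has_laplacian (U \<circ> ?\<rho>) (laplacian ?p1 x * indicator {y. u y = ?p1 y} x +
         laplacian ?p2 x * indicator {y. u y = ?p2 y} x) x"
      by (simp add: indicator_def u_\<rho> p_\<rho>)
    have "open {x. x \<bullet> e < 0}" unfolding inner_commute[of _ e] by (rule open_halfspace_lt)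
    then show ?thesis
      by (rule has_laplacian_open_transform[OF lap]) (use x2 in \<open>auto simp: u_def e\<close>)
  qed
  have nonzero: "normal t \<noteq> 0" "?\<rho> (normal t) \<noteq> 0" for t
  proof -
    show 1: "normal t \<noteq> 0" using normal_inner_self[of t] by (metis inner_zero_left zero_neq_one)
    have "?\<rho> 0 = 0" by (intro vector2_eqI) simp_all
    then show "?\<rho> (normal t) \<noteq> 0" using 1 by (metis reflection_reflection)
  qed
  have "e \<noteq> 0" by (simp add: e_def axis_eq_0_iff)
  have "AE x in lebesgue. x \<bullet> e \<noteq> 0 \<and> x \<bullet> n1 \<noteq> 0 \<and> x \<bullet> n2 \<noteq> 0 \<and> x \<bullet> ?\<rho> n1 \<noteq> 0 \<and> x \<bullet> ?\<rho> n2 \<noteq> 0"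
    unfolding n1_def n2_def by (intro AE_conjI AE_off_hyperplane nonzero \<open>e \<noteq> 0\<close>)
  then have "AE x in lebesgue. has_laplacian u (laplacian ?p1 x * indicator {y. u y = ?p1 y} x +
         laplacian ?p2 x * indicator {y. u y = ?p2 y} x) x"
    by (rule eventually_mono) (elim conjE, rule u_lap)
  then have "double_obstacle_solution ?p1 ?p2 u"
    using \<open>C11_loc u\<close> bounds by (simp add: double_obstacle_solution_def)
  moreover have "halfcone {x. u x = ?p1 x}" unfolding contact1 halfcone_iff_sector
    using \<alpha> by (intro exI[of _ "- \<alpha>"] exI[of _ \<alpha>]) auto
  moreover have "halfcone {x. u x = ?p2 x}" unfolding contact2 halfcone_iff_sector
    using \<gamma> by (intro exI[of _ "pi - \<gamma>"] exI[of _ "pi + \<gamma>"]) auto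
  ultimately have "double_cone_solution ?p1 ?p2 u" by (simp add: double_cone_solution_def)
  then show thesis using contact1 by (rule that)
qed

text \<open>\<open>v\<close> and \<open>w\<close> are the prospective cosine and sine of
  \<open>2 * \<gamma>\<close>. The edge condition gives \<open>v\<^sup>2 + w\<^sup>2 = 1\<close>,
  and \<open>a1 + c1 < 0 < a2 + c2\<close> gives \<open>w > 0\<close>, which puts
  \<open>\<gamma>\<close> strictly between 0 and \<open>pi / 2\<close>.\<close>

lemma double_cone_solution_exists:
  assumes m: "a1 + c1 < 0" "a2 + c2 > 0" and lt: "a1 < a2" "c1 < c2"
    and \<alpha>: "0 < \<alpha>" "\<alpha> < pi / 2" and edge: "edge_condition a1 c1 a2 c2 \<alpha>"
  obtains u where "double_cone_solution (diag_form a1 c1) (diag_form a2 c2) u"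
    and "{x. u x = diag_form a1 c1 x} = sector (- \<alpha>) \<alpha>"
proof -
  define D where "D = (a1 - c1) - (a2 - c2)"
  define v where "v = (D + (a1 + c1) * cos (2 * \<alpha>)) / (a2 + c2)"
  define w where "w = - (a1 + c1) * sin (2 * \<alpha>) / (a2 + c2)"
  have "sin (2 * \<alpha>) > 0" using \<alpha> by (intro sin_gt_zero) auto
  then have "w > 0" unfolding w_def using m by (intro divide_pos_pos mult_pos_pos) auto
  have "(D + (a1 + c1) * cos (2 * \<alpha>))\<^sup>2 + (- (a1 + c1) * sin (2 * \<alpha>))\<^sup>2 =
      D\<^sup>2 + 2 * D * (a1 + c1) * cos (2 * \<alpha>) + (a1 + c1)\<^sup>2 * ((sin (2 * \<alpha>))\<^sup>2 + (cos (2 * \<alpha>))\<^sup>2)"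
    by algebra
  also have "\<dots> = (a2 + c2)\<^sup>2"
    using edge unfolding edge_condition_def D_def[symmetric] sin_cos_squared_add by linarith
  finally have "v\<^sup>2 + w\<^sup>2 = 1"
    using m unfolding v_def w_def power_divide add_divide_distrib[symmetric] by simp
  moreover have "w\<^sup>2 > 0" using \<open>w > 0\<close> by simp
  ultimately have "v\<^sup>2 < 1" by linarith
  then have v: "- 1 < v" "v < 1" by (simp_all add: abs_square_less_1 abs_less_iff)
  define \<gamma> where "\<gamma> = arccos v / 2"
  have \<gamma>: "0 < \<gamma>" "\<gamma> < pi / 2"
    using arccos_lt_bounded[OF v] by (simp_all add: \<gamma>_def)
  have cos\<gamma>: "cos (2 * \<gamma>) = v" using v by (simp add: \<gamma>_def)
  have "sin (2 * \<gamma>) > 0" using \<gamma> by (intro sin_gt_zero) auto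
  moreover have "(sin (2 * \<gamma>))\<^sup>2 = w\<^sup>2" using \<open>v\<^sup>2 + w\<^sup>2 = 1\<close> by (simp add: sin_squared_eq cos\<gamma>)
  ultimately have sin\<gamma>: "sin (2 * \<gamma>) = w"
    using \<open>w > 0\<close> by (simp add: power2_eq_iff_nonneg)
  show thesis
  proof (rule double_cone_solution_construct[OF m lt \<alpha> \<gamma> _ _ that])
    show "(a1 - c1) + (a1 + c1) * cos (2 * \<alpha>) = (a2 - c2) + (a2 + c2) * cos (2 * \<gamma>)"
      using m by (simp add: cos\<gamma> v_def D_def)
    show "(a1 + c1) * sin (2 * \<alpha>) = - (a2 + c2) * sin (2 * \<gamma>)"
      unfolding sin\<gamma> w_def using m by (simp add: field_simps)
  qed
qed

text \<open>The obstacles may change: angles 0, \<open>pi\<close> and \<open>2 * pi\<close> preserve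
  diagonal forms, while \<open>pi / 2\<close> interchanges their coefficients.\<close>

lemma double_cone_solution_reflect:
  assumes u: "double_cone_solution p1 p2 u"
  shows "double_cone_solution (p1 \<circ> reflection \<phi>) (p2 \<circ> reflection \<phi>) (u \<circ> reflection \<phi>)"
proof -
  have "halfcone {x. reflection \<phi> x \<in> K}" if "halfcone K" for K
  proof -
    obtain a b where "0 < b - a" "b - a < pi" "K = sector a b"
      using \<open>halfcone K\<close> unfolding halfcone_iff_sector by blast
    then show ?thesis
      unfolding halfcone_iff_sector
      by (intro exI[of _ "\<phi> - b"] exI[of _ "\<phi> - a"]) (simp add: reflection_sector)
  qed
  from this[of "{x. u x = p1 x}"] this[of "{x. u x = p2 x}"] show ?thesis
    using u double_obstacle_solution_compose_involution[OF orthogonal_reflection reflection_reflection]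
    by (simp add: double_cone_solution_def)
qed

text \<open>The construction covers the sector around the positive first axis, and a reflection in
  the second axis gives its opposite. Interchanging the coordinates swaps each \<open>a\<close> with
  its \<open>c\<close> and turns \<open>\<alpha>\<close> into \<open>pi / 2 - \<alpha>\<close>,
  which gives the third sector; its reflection in the first axis is the fourth.\<close>

lemma four_contact_sectors:
  assumes m: "a1 + c1 < 0" "a2 + c2 > 0" and lt: "a1 < a2" "c1 < c2"
    and \<alpha>: "0 < \<alpha>" "\<alpha> < pi / 2" and edge: "edge_condition a1 c1 a2 c2 \<alpha>"
    and S: "S \<in> {sector (- \<alpha>) \<alpha>, sector (pi - \<alpha>) (pi + \<alpha>), sector \<alpha> (pi - \<alpha>), sector (pi + \<alpha>) (2 * pi - \<alpha>)}"
  shows "\<exists>u. double_cone_solution (diag_form a1 c1) (diag_form a2 c2) u \<and> {x. u x = diag_form a1 c1 x} = S"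
proof -
  let ?ex = "\<lambda>S. \<exists>u. double_cone_solution (diag_form a1 c1) (diag_form a2 c2) u \<and> {x. u x = diag_form a1 c1 x} = S"
  have contact: "{x. (u \<circ> reflection \<phi>) x = (p \<circ> reflection \<phi>) x} = sector (\<phi> - t) (\<phi> - s)"
    if "{x. u x = p x} = sector s t" for u p :: "real^2 \<Rightarrow> real" and \<phi> s t
    using reflection_sector[of \<phi> s t] unfolding that[symmetric] by simp
  have reflect: "?ex (sector (\<phi> - t) (\<phi> - s))" if ex: "?ex (sector s t)" and \<phi>: "sin \<phi> = 0" for \<phi> s t
  proof -
    have "(cos \<phi>)\<^sup>2 = 1" using sin_cos_squared_add[of \<phi>] \<phi> by simp
    then have inv: "diag_form a c \<circ> reflection \<phi> = diag_form a c" for a c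
      using \<phi> by (auto simp: diag_form_def fun_eq_iff power_mult_distrib)
    obtain u where u: "double_cone_solution (diag_form a1 c1) (diag_form a2 c2) u" "{x. u x = diag_form a1 c1 x} = sector s t"
      using ex by blast
    show ?thesis
      using double_cone_solution_reflect[OF u(1), of \<phi>] contact[OF u(2), of \<phi>] unfolding inv by blast
  qed
  have 1: "?ex (sector (- \<alpha>) \<alpha>)"
    using double_cone_solution_exists[OF m lt \<alpha> edge] by metis
  have 2: "?ex (sector (pi - \<alpha>) (pi + \<alpha>))"
    using reflect[OF 1, of pi] by simp
  have 3: "?ex (sector \<alpha> (pi - \<alpha>))"
  proof -
    have "edge_condition c1 a1 c2 a2 (pi / 2 - \<alpha>)"
    proof -
      have cos: "cos (2 * (pi / 2 - \<alpha>)) = - cos (2 * \<alpha>)" by (simp add: right_diff_distrib cos_diff)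
      have "2 * ((c1 - a1) - (c2 - a2)) * (c1 + a1) * - cos (2 * \<alpha>) =
          2 * ((a1 - c1) - (a2 - c2)) * (a1 + c1) * cos (2 * \<alpha>)"
        by algebra
      also have "\<dots> = (a2 + c2)\<^sup>2 - (a1 + c1)\<^sup>2 - ((a1 - c1) - (a2 - c2))\<^sup>2"
        using edge by (simp only: edge_condition_def)
      also have "\<dots> = (c2 + a2)\<^sup>2 - (c1 + a1)\<^sup>2 - ((c1 - a1) - (c2 - a2))\<^sup>2"
        by algebra
      finally show ?thesis unfolding edge_condition_def cos .
    qed
    then obtain w where w: "double_cone_solution (diag_form c1 a1) (diag_form c2 a2) w"
        "{x. w x = diag_form c1 a1 x} = sector (- (pi / 2 - \<alpha>)) (pi / 2 - \<alpha>)"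
      using double_cone_solution_exists[of c1 a1 c2 a2 "pi / 2 - \<alpha>"] m lt \<alpha> by (auto simp: add.commute)
    have swap: "diag_form c a \<circ> reflection (pi / 2) = diag_form a c" for a c
      by (auto simp: diag_form_def fun_eq_iff)
    have "pi / 2 - (pi / 2 - \<alpha>) = \<alpha>" "pi / 2 - - (pi / 2 - \<alpha>) = pi - \<alpha>" by (simp_all add: field_simps)
    then have "sector (pi / 2 - (pi / 2 - \<alpha>)) (pi / 2 - - (pi / 2 - \<alpha>)) = sector \<alpha> (pi - \<alpha>)"
      by (simp only:)
    then show ?thesis
      using double_cone_solution_reflect[OF w(1), of "pi / 2"] contact[OF w(2), of "pi / 2"] unfolding swap
      by (intro exI[of _ "w \<circ> reflection (pi / 2)"]) simp
  qed
  have 4: "?ex (sector (pi + \<alpha>) (2 * pi - \<alpha>))"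
    using reflect[OF 3, of "2 * pi"] by (simp add: algebra_simps)
  show ?thesis using S 1 2 3 4 by blast
qed

section \<open>Number of double-cone solutions\<close>

lemma card_four_sectors:
  assumes "0 < \<alpha>" "\<alpha> < pi / 2"
  shows "card {sector (- \<alpha>) \<alpha>, sector (pi - \<alpha>) (pi + \<alpha>), sector \<alpha> (pi - \<alpha>), sector (pi + \<alpha>) (2 * pi - \<alpha>)} = 4"
proof -
  let ?S = "sector (- \<alpha>) \<alpha>" and ?T = "sector (pi - \<alpha>) (pi + \<alpha>)"
    and ?V = "sector \<alpha> (pi - \<alpha>)" and ?W = "sector (pi + \<alpha>) (2 * pi - \<alpha>)"
  have out: "dir t \<notin> sector a b" if "b < t" "t < a + 2 * pi" for t a b
    using notin_sector[of 1 b t a] that by simp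
  have period: "dir (t + 2 * pi) = dir t" for t
    using dir_plus_2pi[of t 1] by simp
  \<comment> \<open>The bisectors of three sectors tell all pairs apart; an angle below the sector
    to be avoided is raised by a full turn to fit \<open>notin_sector\<close>.\<close>
  have "dir 0 \<in> ?S" "dir pi \<in> ?T" "dir (pi / 2) \<in> ?V"
    using in_sectorI[of 1 0 "- \<alpha>" \<alpha>] in_sectorI[of 1 pi "pi - \<alpha>" "pi + \<alpha>"] in_sectorI[of 1 "pi / 2" \<alpha> "pi - \<alpha>"] assms
    by simp_all
  moreover have "dir (0 + 2 * pi) \<notin> ?T" "dir (0 + 2 * pi) \<notin> ?V" "dir (0 + 2 * pi) \<notin> ?W"
    using assms by (intro out; simp)+
  moreover have "dir pi \<notin> ?V" "dir (pi + 2 * pi) \<notin> ?W" "dir (pi / 2 + 2 * pi) \<notin> ?W"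
    using assms by (intro out; simp)+
  ultimately have "?S \<noteq> ?T" "?S \<noteq> ?V" "?S \<noteq> ?W" "?T \<noteq> ?V" "?T \<noteq> ?W" "?V \<noteq> ?W"
    unfolding period by metis+
  then show ?thesis by simp
qed

text \<open>Both sides of \<open>edge_condition\<close> vanish, so every \<open>\<alpha>\<close>
  between 0 and \<open>pi / 2\<close> gives a solution, and different openings give different
  contact sets.\<close>

lemma infinite_double_cone_solutions:
  assumes m: "a1 + c1 < 0" "a2 + c2 > 0" and lt: "a1 < a2" "c1 < c2"
    and zero: "a1 + c2 = 0" "c1 + a2 = 0"
  shows "infinite {u. double_cone_solution (diag_form a1 c1) (diag_form a2 c2) u}" (is "infinite ?Sol")
proof -
  have "(a2 + c2) = - (a1 + c1)" "(a1 - c1) - (a2 - c2) = 0" using zero by linarith+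
  then have edge: "edge_condition a1 c1 a2 c2 \<alpha>" for \<alpha>
    unfolding edge_condition_def by (simp only: power2_minus) simp
  have "inj_on (\<lambda>\<alpha>. sector (- \<alpha>) \<alpha>) {0<..<pi / 2}"
  proof (rule linorder_inj_onI)
    fix \<alpha> \<beta> :: real assume "\<alpha> < \<beta>" "\<alpha> \<in> {0<..<pi / 2}" "\<beta> \<in> {0<..<pi / 2}"
    then have "1 *\<^sub>R dir \<beta> \<in> sector (- \<beta>) \<beta>" "1 *\<^sub>R dir \<beta> \<notin> sector (- \<alpha>) \<alpha>"
      by (intro in_sectorI notin_sector; simp)+
    then show "sector (- \<alpha>) \<alpha> \<noteq> sector (- \<beta>) \<beta>" by metis
  qed auto
  then have "infinite ((\<lambda>\<alpha>. sector (- \<alpha>) \<alpha>) ` {0<..<pi / 2})"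
    by (simp add: finite_image_iff infinite_Ioo)
  moreover have "(\<lambda>\<alpha>. sector (- \<alpha>) \<alpha>) ` {0<..<pi / 2} \<subseteq> (\<lambda>u. {x. u x = diag_form a1 c1 x}) ` ?Sol"
  proof clarify
    fix \<alpha> :: real assume "\<alpha> \<in> {0<..<pi / 2}"
    then obtain u where "double_cone_solution (diag_form a1 c1) (diag_form a2 c2) u" "{x. u x = diag_form a1 c1 x} = sector (- \<alpha>) \<alpha>"
      using double_cone_solution_exists[OF m lt _ _ edge, of \<alpha>] by auto
    then show "sector (- \<alpha>) \<alpha> \<in> (\<lambda>u. {x. u x = diag_form a1 c1 x}) ` ?Sol" by blast
  qed
  ultimately show ?thesis using finite_surj by blast
qed

text \<open>The contact set with \<open>p1\<close> maps the solutions bijectively onto four sectors.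
  Since \<open>card\<close> is 0 on infinite sets, the value 4 includes finiteness.\<close>

lemma card_double_cone_solutions:
  assumes m: "a1 + c1 < 0" "a2 + c2 > 0" and lt: "a1 < a2" "c1 < c2"
    and sign: "(a1 + c2) * (c1 + a2) < 0"
  shows "card {u. double_cone_solution (diag_form a1 c1) (diag_form a2 c2) u} = 4" (is "card ?Sol = 4")
proof -
  define D where "D = (a1 - c1) - (a2 - c2)"
  define M where "M = (a2 + c2)\<^sup>2 - (a1 + c1)\<^sup>2 - D\<^sup>2"
  \<comment> \<open>\<open>K\<close> is the cosine prescribed by \<open>edge_condition\<close>;
    opposite signs of the coefficients of \<open>P\<close> make its modulus less than 1.\<close>
  define K where "K = M / (2 * D * (a1 + c1))"
  have "a1 + c2 \<noteq> c1 + a2"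
  proof
    assume "a1 + c2 = c1 + a2"
    then have "(a1 + c2) * (c1 + a2) = (c1 + a2)\<^sup>2" by (simp only: power2_eq_square)
    with sign show False by simp
  qed
  then have "D \<noteq> 0" by (auto simp: D_def)
  have "(2 * D * (a1 + c1))\<^sup>2 - M\<^sup>2 = - 16 * (a2 - a1) * (c2 - c1) * ((a1 + c2) * (c1 + a2))"
    unfolding M_def D_def by algebra
  moreover have "16 * (a2 - a1) * (c2 - c1) * ((a1 + c2) * (c1 + a2)) < 0"
    using mult_pos_neg[OF _ sign, of "16 * (a2 - a1) * (c2 - c1)"] lt by simp
  ultimately have "M\<^sup>2 < (2 * D * (a1 + c1))\<^sup>2" by linarith
  then have "K\<^sup>2 < 1"
    unfolding K_def power_divide by (subst divide_less_eq_1_pos) (use \<open>D \<noteq> 0\<close> m in auto)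
  then have K: "- 1 < K" "K < 1" by (simp_all add: abs_square_less_1 abs_less_iff)
  define \<alpha> where "\<alpha> = arccos K / 2"
  have \<alpha>: "0 < \<alpha>" "\<alpha> < pi / 2" using arccos_lt_bounded[OF K] by (simp_all add: \<alpha>_def)
  have cos\<alpha>: "cos (2 * \<alpha>) = K" using K by (simp add: \<alpha>_def)
  have edge: "edge_condition a1 c1 a2 c2 \<alpha>"
    unfolding edge_condition_def cos\<alpha> D_def[symmetric] M_def[symmetric] using \<open>D \<noteq> 0\<close> m by (simp add: K_def)
  let ?contact = "\<lambda>u. {x. u x = diag_form a1 c1 x}"
  let ?sectors = "{sector (- \<alpha>) \<alpha>, sector (pi - \<alpha>) (pi + \<alpha>), sector \<alpha> (pi - \<alpha>), sector (pi + \<alpha>) (2 * pi - \<alpha>)}"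
  have "?contact ` ?Sol \<subseteq> ?sectors"
  proof (rule image_subsetI)
    fix u assume "u \<in> ?Sol"
    then have u: "double_cone_solution (diag_form a1 c1) (diag_form a2 c2) u" by simp
    obtain a b where ab: "0 < b - a" "b - a < pi" "?contact u = sector a b"
      using u by (auto simp: double_cone_solution_def halfcone_iff_sector)
    then obtain c d where "cone_configuration a1 c1 a2 c2 u a b c d"
      using cone_configuration_exists[OF lt u, of a b] by auto
    note edges = cone_configuration_edges[OF this]
    have "sector a b \<in> ?sectors"
      using ab m \<open>a1 + c2 \<noteq> c1 + a2\<close>
      by (intro contact_sector_cases[OF \<alpha>] cos_eq_edges[OF edges(1) edge] cos_eq_edges[OF edges(2) edge]) auto
    then show "?contact u \<in> ?sectors" by (simp only: ab(3))
  qed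
  moreover have "?sectors \<subseteq> ?contact ` ?Sol"
  proof
    fix S assume "S \<in> ?sectors"
    from four_contact_sectors[OF m lt \<alpha> edge this] show "S \<in> ?contact ` ?Sol" by blast
  qed
  ultimately have "?contact ` ?Sol = ?sectors" by (rule subset_antisym)
  moreover have "inj_on ?contact ?Sol"
    by (rule inj_onI) (use double_cone_solution_unique[OF lt] in blast)
  ultimately show ?thesis
    using card_image[of ?contact ?Sol] card_four_sectors[OF \<alpha>] by metis
qed

theorem corollary3p9:
  fixes a1 a2 c1 c2 :: real and p1 p2 P :: "real^2 \<Rightarrow> real"
  assumes "a1 < a2" and "c1 < c2" and "a1 + c1 < 0" and "a2 + c2 > 0"
    and "\<And>x. p1 x = a1 * (x$1)^2 + c1 * (x$2)^2"
    and "\<And>x. p2 x = a2 * (x$1)^2 + c2 * (x$2)^2"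
    and "\<And>x. P x = p1 x + p2 (vector [x$2, x$1])"
  shows "(\<forall>x. P x = (a1 + c2) * (x$1)^2 + (c1 + a2) * (x$2)^2) \<and>
    ((\<exists>u. double_cone_solution p1 p2 u) \<longleftrightarrow> \<not> has_sign P) \<and>
    ((\<forall>x. P x = 0) \<longrightarrow> infinite {u. double_cone_solution p1 p2 u}) \<and>
    (changes_sign P \<longrightarrow> card {u. double_cone_solution p1 p2 u} = 4) \<and>
    (has_sign P \<longrightarrow> {u. double_cone_solution p1 p2 u} = {})"
proof -
  note lt = assms(1,2) and m = assms(3,4)
  define A C where "A = a1 + c2" and "C = c1 + a2"
  have p: "p1 = diag_form a1 c1" "p2 = diag_form a2 c2"
    using assms(5,6) by (simp_all add: fun_eq_iff diag_form_def)
  have P: "P x = A * (x$1)^2 + C * (x$2)^2" for x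
    by (simp add: assms(5-7) A_def C_def algebra_simps)
  \<comment> \<open>On the unit vectors \<open>P\<close> takes its coefficients as values, so sign
    statements about \<open>P\<close> pass to \<open>A\<close> and \<open>C\<close>.\<close>
  have P_axes: "P (axis 1 1) = A" "P (axis 2 1) = C" by (simp_all add: P axis_def)
  have sign: "A * C \<ge> 0 \<and> (A \<noteq> 0 \<or> C \<noteq> 0)" if "has_sign P"
    using that P_axes unfolding has_sign_def P
    by (metis add.right_neutral mult_nonneg_nonneg mult_nonpos_nonpos mult_zero_left)
  have change: "A * C < 0" if "changes_sign P"
  proof (rule ccontr)
    assume "\<not> A * C < 0"
    then have "A \<ge> 0 \<and> C \<ge> 0 \<or> A \<le> 0 \<and> C \<le> 0" by (auto simp: mult_less_0_iff)
    then have "(\<forall>x. P x \<ge> 0) \<or> (\<forall>x. P x \<le> 0)"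
    proof (elim disjE conjE)
      assume "A \<ge> 0" "C \<ge> 0"
      then show ?thesis by (simp add: P)
    next
      assume "A \<le> 0" "C \<le> 0"
      then show ?thesis by (simp add: P add_nonpos_nonpos mult_nonpos_nonneg)
    qed
    then show False using that unfolding changes_sign_def by (meson not_le)
  qed
  have no_sign: "(\<forall>x. P x = 0) \<or> changes_sign P" if "\<not> has_sign P"
    using that unfolding has_sign_def changes_sign_def by (meson not_le)
  have zero: "A = 0 \<and> C = 0" if "\<forall>x. P x = 0"
    using that P_axes by metis
  have inf: "infinite {u. double_cone_solution p1 p2 u}" if "\<forall>x. P x = 0"
    using infinite_double_cone_solutions[OF m lt] zero[OF that] by (simp add: p A_def C_def)
  have four: "card {u. double_cone_solution p1 p2 u} = 4" if "changes_sign P"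
    using card_double_cone_solutions[OF m lt] change[OF that] by (simp add: p A_def C_def)
  have none: "{u. double_cone_solution p1 p2 u} = {}" if "has_sign P"
    using no_double_cone_solution[OF lt m] sign[OF that] by (simp add: p A_def C_def)
  have "(\<exists>u. double_cone_solution p1 p2 u) \<longleftrightarrow> \<not> has_sign P"
  proof
    assume "\<not> has_sign P"
    then have "{u. double_cone_solution p1 p2 u} \<noteq> {}"
      using no_sign inf four by force
    then show "\<exists>u. double_cone_solution p1 p2 u" by blast
  qed (use none in blast)
  then show ?thesis using P inf four none by (simp add: A_def C_def)
qed

end
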